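(* Assume that all men and women have popularity preferences, drawn independently. Let $N=\min(M,W)$. Let \[R_{\mathcal M}=\max_{m\in\mathcal M;\ w_0,w_1\in\mathcal W}\frac{\mathcal D_m(w_0)}{\mathcal D_m(w_1)},\qquad Q_{\mathcal W}=\max_{w_0,w_1\in\mathcal W;\ m_0,m_1\in\mathcal M}\frac{\mathcal D_{w_0}(m_0)}{\mathcal D_{w_0}(m_1)}\cdot\frac{\mathcal D_{w_1}(m_1)}{\mathcal D_{w_1}(m_0)}.\] Let $w$ be a woman. Then with probability at least $1-\frac{2}{N^2}$, for any two stable husbands $h,h'$ of $w$, \[\frac{\mathcal D_w(h)}{\mathcal D_w(h')}\le\left(N^5\cdot Q_{\mathcal W}\right)^{1+\frac{4\ln(N)(1+\log_2(N))}{\ln(1+1/R_{\mathcal M})}}.\]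
   Context: Popularity preferences: a person $p$ assigns positive popularities $\mathcal D_p(q)$, summing to $1$, to his/her acceptable partners $q$. He or she ranks them by successively drawing the next favourite, without replacement, with probability proportional to $\mathcal D_p$. The maxima defining $R_{\mathcal M}$ and $Q_{\mathcal W}$ range over all indicated persons. A matching is stable if no man–woman pair prefer each other to their partners and no one is matched to an unacceptable partner. A stable husband of $w$ is a man matched to $w$ in some stable matching. *)

theory Defs
  imports "HOL-Probability.Probability"
begin

(* The popularities assigned by a person form a pmf D on the other side: D is positive exactly on
   the acceptable partners, so set_pmf D is the set of acceptable partners. *)

(* The preference list drawn from the popularities D when the persons in A are still available.
   cond_pmf D A picks q in A with probability proportional to D(q).  The list contains exactly the
   acceptable members of A, favourite first. *)
function draw_list :: "'a::finite pmf \<Rightarrow> 'a set \<Rightarrow> 'a list pmf" where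
  "draw_list D A =
     (if set_pmf D \<inter> A = {} then return_pmf []
      else bind_pmf (cond_pmf D A) (\<lambda>q. map_pmf ((#) q) (draw_list D (A - {q}))))"
  by pat_completeness auto
termination
proof (relation "Wellfounded.measure (\<lambda>(_, A). card A)")
  fix D :: "'a pmf" and A q
  assume ne: "set_pmf D \<inter> A \<noteq> {}" and q: "q \<in> set_pmf (cond_pmf D A)"
  from q have "q \<in> A" by (simp add: set_cond_pmf[OF ne])
  then show "((D, A - {q}), (D, A)) \<in> Wellfounded.measure (\<lambda>(_, A). card A)"
    by (simp add: card_Diff1_less del: card_Diff_insert card_Diff_singleton)
qed simp

declare draw_list.simps [simp del]

definition popularity_list :: "'a::finite pmf \<Rightarrow> 'a list pmf" where
  "popularity_list D = draw_list D UNIV"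

(* All lists are drawn independently.  The default value [] of Pi_pmf is irrelevant, as the index
   sets are full types. *)
definition popularity_profile ::
  "('m::finite \<Rightarrow> 'w::finite pmf) \<Rightarrow> ('w \<Rightarrow> 'm pmf) \<Rightarrow> (('m \<Rightarrow> 'w list) \<times> ('w \<Rightarrow> 'm list)) pmf"
  where
  "popularity_profile DM DW =
     pair_pmf (Pi_pmf UNIV [] (\<lambda>m. popularity_list (DM m)))
              (Pi_pmf UNIV [] (\<lambda>w. popularity_list (DW w)))"

definition ranked_before :: "'a list \<Rightarrow> 'a \<Rightarrow> 'a \<Rightarrow> bool" where
  "ranked_before l x y \<longleftrightarrow> (\<exists>i j. i < j \<and> j < length l \<and> l ! i = x \<and> l ! j = y)"

(* P is the set of current partners, empty for a single person and a singleton otherwise; a single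
   person prefers every acceptable partner to staying alone. *)
definition prefers_to_partner :: "'a list \<Rightarrow> 'a \<Rightarrow> 'a set \<Rightarrow> bool" where
  "prefers_to_partner l q P \<longleftrightarrow> q \<in> set l \<and> (\<forall>p\<in>P. ranked_before l q p)"

(* Matchings may leave persons of both sides single. *)
definition is_matching :: "('m \<times> 'w) set \<Rightarrow> bool" where
  "is_matching \<mu> \<longleftrightarrow> single_valued \<mu> \<and> single_valued (\<mu>\<inverse>)"

definition stable_matching :: "('m \<Rightarrow> 'w list) \<Rightarrow> ('w \<Rightarrow> 'm list) \<Rightarrow> ('m \<times> 'w) set \<Rightarrow> bool" where
  "stable_matching PM PW \<mu> \<longleftrightarrow>
     is_matching \<mu> \<and>
     (\<forall>(m, w)\<in>\<mu>. w \<in> set (PM m) \<and> m \<in> set (PW w)) \<and>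
     \<not> (\<exists>m w. prefers_to_partner (PM m) w (\<mu> `` {m}) \<and>
              prefers_to_partner (PW w) m (\<mu>\<inverse> `` {w}))"

definition stable_husband :: "('m \<Rightarrow> 'w list) \<Rightarrow> ('w \<Rightarrow> 'm list) \<Rightarrow> 'w \<Rightarrow> 'm \<Rightarrow> bool" where
  "stable_husband PM PW w h \<longleftrightarrow> (\<exists>\<mu>. stable_matching PM PW \<mu> \<and> (h, w) \<in> \<mu>)"

(* The maxima below range over all persons, so an unacceptable partner may occur in a denominator.
   They are therefore taken in ennreal, where x / 0 = \<infinity> for x > 0 and 0 / 0 = 0.  If all
   partners are acceptable, they are maxima of positive real numbers. *)

definition R_men :: "('m::finite \<Rightarrow> 'w::finite pmf) \<Rightarrow> ennreal" where
  "R_men D =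
     (MAX (m, w\<^sub>0, w\<^sub>1) \<in> UNIV. ennreal (pmf (D m) w\<^sub>0) / ennreal (pmf (D m) w\<^sub>1))"

definition Q_women :: "('w::finite \<Rightarrow> 'm::finite pmf) \<Rightarrow> ennreal" where
  "Q_women D =
     (MAX (w\<^sub>0, w\<^sub>1, m\<^sub>0, m\<^sub>1) \<in> UNIV.
        (ennreal (pmf (D w\<^sub>0) m\<^sub>0) / ennreal (pmf (D w\<^sub>0) m\<^sub>1)) *
        (ennreal (pmf (D w\<^sub>1) m\<^sub>1) / ennreal (pmf (D w\<^sub>1) m\<^sub>0)))"

lemma R_men_finite_iff: "R_men D < \<infinity> \<longleftrightarrow> (\<forall>m. set_pmf (D m) = UNIV)"
proof
  assume fin: "R_men D < \<infinity>"
  show "\<forall>m. set_pmf (D m) = UNIV"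
  proof (rule ccontr)
    assume "\<not> (\<forall>m. set_pmf (D m) = UNIV)"
    then obtain m w\<^sub>1 where w1: "pmf (D m) w\<^sub>1 = 0"
      by (auto simp: set_pmf_iff)
    obtain w\<^sub>0 where w0: "pmf (D m) w\<^sub>0 > 0"
      using set_pmf_not_empty[of "D m"] by (auto simp: set_pmf_eq order.strict_iff_order)
    have "ennreal (pmf (D m) w\<^sub>0) / ennreal (pmf (D m) w\<^sub>1) \<le> R_men D"
      unfolding R_men_def by (rule Max_ge) (auto intro!: image_eqI[of _ _ "(m, w\<^sub>0, w\<^sub>1)"])
    with w0 w1 have "R_men D = \<infinity>"
      by (simp add: ennreal_divide_eq_top_iff top_unique)
    with fin show False by simp
  qed
next
  assume "\<forall>m. set_pmf (D m) = UNIV"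
  then have "pmf (D m) w > 0" for m w
    by (metis UNIV_I pmf_positive)
  then have "ennreal (pmf (D m) w\<^sub>0) / ennreal (pmf (D m) w\<^sub>1) < \<infinity>" for m w\<^sub>0 w\<^sub>1
    by (simp add: divide_ennreal)
  then show "R_men D < \<infinity>"
    unfolding R_men_def by (subst Max_less_iff) auto
qed

lemma Q_women_finite: "Q_women D < \<infinity>" if "\<And>w. set_pmf (D w) = UNIV"
proof -
  have "pmf (D w) m > 0" for w m
    using that by (metis UNIV_I pmf_positive)
  then have "ennreal (pmf (D w\<^sub>0) m\<^sub>0) / ennreal (pmf (D w\<^sub>0) m\<^sub>1) *
      (ennreal (pmf (D w\<^sub>1) m\<^sub>1) / ennreal (pmf (D w\<^sub>1) m\<^sub>0)) < \<infinity>" for w\<^sub>0 w\<^sub>1 m\<^sub>0 m\<^sub>1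
    by (simp add: divide_ennreal ennreal_mult_less_top)
  then show ?thesis
    unfolding Q_women_def by (subst Max_less_iff) auto
qed

end

theory Submission
  imports Defs
begin

text \<open>
  Run deferred acceptance with \<open>w\<close> turning down everybody, the men getting their first turns in order
  of decreasing popularity for \<open>w\<close>.  If \<open>h\<close> and \<open>h'\<close> are stable husbands of \<open>w\<close> and she prefers
  \<open>h'\<close>, then \<open>h'\<close> proposes to her, and only after the first turn of \<open>h\<close>.  On a logarithmic scale of
  popularity whose unit is the factor \<open>N\<^sup>5 Q\<close>, all women who receive proposals prefer, with high
  probability, a man who is at least two levels higher; so a man who is displaced is at most one level
  above the man who displaces him, and \<open>h'\<close> can be much more popular than \<open>h\<close> only if a chain of
  proposals climbs through many levels.  In an interval of levels in which the number of men below does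
  not double, a climbing man is accepted by the wife of a man below the interval before being accepted
  inside it with probability at least \<open>1 / (1 + R)\<close>.  Such an interval exists among any \<open>log\<^sub>2 N\<close>
  consecutive ones, and the at most \<open>N\<^sup>2\<close> attempts to climb through one succeed with probability at
  most \<open>N\<^sup>-\<^sup>4\<close> each.
\<close>

subsection \<open>Finite probabilities\<close>


text \<open>The bounds involve only \<open>N\<close>, although one side of the market may be far
  larger; this shapes the whole estimate. A union bound over all women is avoided because whether a
  woman receives a proposal does not depend on her own list, and at most \<open>n + 1\<close> women
  count as \<open>hit\<close>. The men's lists are revealed proposal by proposal while the women's
  lists are fixed. Finiteness of \<open>R_men\<close> makes every woman acceptable to every man;
  finiteness of \<open>Q_women\<close> gives all women the same set \<open>Y\<close> of acceptable
  men. The allowed failure \<open>2 / N\<^sup>2\<close> has two main shares. About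
  \<open>N ^ 3\<close> comparisons, of two men by a woman, each go wrong with probability at most
  \<open>1 / N ^ 5\<close>: hence the factor \<open>N ^ 5\<close>. About \<open>N\<^sup>2\<close>
  starts of a climb each succeed with probability at most \<open>1 / N ^ 4\<close>: hence the 4 in
  the exponent. Stable husbands so unpopular that level 0 hides how unpopular they are form a third,
  negligible failure.\<close>

lemma prob_bind_pmf:
  "measure_pmf.prob (bind_pmf p f) S = measure_pmf.expectation p (\<lambda>x. measure_pmf.prob (f x) S)"
proof -
  have "ennreal (measure_pmf.prob (bind_pmf p f) S) = (\<integral>\<^sup>+x. ennreal (measure_pmf.prob (f x) S) \<partial>p)"
    by (simp add: measure_pmf.emeasure_eq_measure[symmetric])
  also have "\<dots> = ennreal (measure_pmf.expectation p (\<lambda>x. measure_pmf.prob (f x) S))"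
    by (intro nn_integral_eq_integral measure_pmf.integrable_const_bound[where B = 1]) auto
  finally show ?thesis
    by (simp add: integral_nonneg)
qed

lemma prob_bind_pmf_le:
  fixes p :: "'a::finite pmf"
  assumes "\<And>x. x \<in> set_pmf p \<Longrightarrow> measure_pmf.prob (f x) S \<le> g x"
  shows "measure_pmf.prob (bind_pmf p f) S \<le> (\<Sum>x\<in>UNIV. pmf p x * g x)"
proof -
  have "measure_pmf.prob (bind_pmf p f) S = (\<Sum>x\<in>UNIV. pmf p x * measure_pmf.prob (f x) S)"
    by (subst prob_bind_pmf, subst integral_measure_pmf[of UNIV]) simp_all
  also have "\<dots> \<le> (\<Sum>x\<in>UNIV. pmf p x * g x)"
    using assms by (intro sum_mono) (metis mult_left_mono mult_zero_left order_refl pmf_eq_0_set_pmf pmf_nonneg)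
  finally show ?thesis .
qed

lemma prob_bind_pmf_le_const:
  assumes "\<And>x. x \<in> set_pmf p \<Longrightarrow> measure_pmf.prob (f x) S \<le> c"
  shows "measure_pmf.prob (bind_pmf p f) S \<le> c"
proof -
  have "measure_pmf.prob (bind_pmf p f) S = measure_pmf.expectation p (\<lambda>x. measure_pmf.prob (f x) S)"
    by (rule prob_bind_pmf)
  also have "\<dots> \<le> measure_pmf.expectation p (\<lambda>x. c)"
    by (rule integral_mono_AE) (auto simp: AE_measure_pmf_iff assms intro: measure_pmf.integrable_const_bound[where B = 1])
  finally show ?thesis by simp
qed

lemma prob_pair_pmf_le:
  assumes "\<And>y. y \<in> set_pmf q \<Longrightarrow> measure_pmf.prob p {x. P x y} \<le> c"
  shows "measure_pmf.prob (pair_pmf p q) {(x, y). P x y} \<le> c"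
proof -
  have "pair_pmf p q = bind_pmf q (\<lambda>y. map_pmf (\<lambda>x. (x, y)) p)"
    unfolding pair_pmf_def map_pmf_def by (rule bind_commute_pmf)
  then show ?thesis
    by (auto intro!: prob_bind_pmf_le_const assms simp: vimage_def)
qed

lemma prob_mono_pmf:
  assumes "\<And>x. x \<in> set_pmf p \<Longrightarrow> x \<in> A \<Longrightarrow> x \<in> B"
  shows "measure_pmf.prob p A \<le> measure_pmf.prob p B"
  by (rule measure_pmf.finite_measure_mono_AE) (auto simp: AE_measure_pmf_iff assms)

lemma prob_Un_le:
  "measure_pmf.prob p A \<le> a \<Longrightarrow> measure_pmf.prob p B \<le> b \<Longrightarrow> measure_pmf.prob p (A \<union> B) \<le> a + b"
  using measure_Un_le[of A "measure_pmf p" B] by simp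

lemma prob_UN_le:
  assumes "finite I" "\<And>i. i \<in> I \<Longrightarrow> measure_pmf.prob p (A i) \<le> b i"
  shows "measure_pmf.prob p (\<Union>i\<in>I. A i) \<le> (\<Sum>i\<in>I. b i)"
  using measure_UNION_le[of I A "measure_pmf p"] sum_mono[of I "\<lambda>i. measure_pmf.prob p (A i)" b] assms
  by fastforce

lemma sum_pmf_cond:
  fixes D :: "'a::finite pmf"
  assumes "set_pmf D \<inter> A \<noteq> {}"
  shows "(\<Sum>x\<in>UNIV. pmf (cond_pmf D A) x * g x) = (\<Sum>x\<in>A. pmf D x * g x) / measure_pmf.prob D A"
proof -
  have "(\<Sum>x\<in>UNIV. pmf (cond_pmf D A) x * g x) = (\<Sum>x\<in>A. pmf (cond_pmf D A) x * g x)"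
    by (intro sum.mono_neutral_right) (auto simp: pmf_cond[OF assms])
  also have "\<dots> = (\<Sum>x\<in>A. pmf D x * g x / measure_pmf.prob D A)"
    by (intro sum.cong) (auto simp: pmf_cond[OF assms])
  finally show ?thesis by (simp add: sum_divide_distrib)
qed

section \<open>Random preference list of one person\<close>

lemma draw_list_support:
  assumes "l \<in> set_pmf (draw_list D A)"
  shows "distinct l \<and> set l = set_pmf D \<inter> A"
  using assms
proof (induction D A arbitrary: l rule: draw_list.induct)
  case (1 D A)
  show ?case
  proof (cases "set_pmf D \<inter> A = {}")
    case True
    then show ?thesis using 1(2) by (subst (asm) draw_list.simps) auto
  next
    case False
    then obtain q l' where q: "q \<in> set_pmf (cond_pmf D A)" "l' \<in> set_pmf (draw_list D (A - {q}))" "l = q # l'"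
      using 1(2) by (subst (asm) draw_list.simps) auto
    from 1(1)[OF False q(1,2)] q(1) show ?thesis
      by (auto simp: set_cond_pmf[OF False] q(3))
  qed
qed

lemma ranked_before_Cons:
  "ranked_before (q # l) x y \<longleftrightarrow> (q = x \<and> y \<in> set l) \<or> ranked_before l x y"
proof
  assume "ranked_before (q # l) x y"
  then obtain i j where ij: "i < j" "j < length (q # l)" "(q # l) ! i = x" "(q # l) ! j = y"
    unfolding ranked_before_def by blast
  then obtain j' where j: "j = Suc j'" by (cases j) auto
  show "(q = x \<and> y \<in> set l) \<or> ranked_before l x y"
  proof (cases i)
    case 0
    then show ?thesis using ij j by auto
  next
    case (Suc i')
    then have "ranked_before l x y" unfolding ranked_before_def
      using ij j by (intro exI[of _ i'] exI[of _ j']) auto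
    then show ?thesis by blast
  qed
next
  assume "(q = x \<and> y \<in> set l) \<or> ranked_before l x y"
  then show "ranked_before (q # l) x y"
  proof
    assume "q = x \<and> y \<in> set l"
    then obtain j where "j < length l" "l ! j = y" "q = x" by (auto simp: in_set_conv_nth)
    then show ?thesis unfolding ranked_before_def
      by (intro exI[of _ 0] exI[of _ "Suc j"]) auto
  next
    assume "ranked_before l x y"
    then obtain i j where "i < j" "j < length l" "l ! i = x" "l ! j = y"
      unfolding ranked_before_def by blast
    then show ?thesis unfolding ranked_before_def
      by (intro exI[of _ "Suc i"] exI[of _ "Suc j"]) auto
  qed
qed

lemma ranked_before_Nil [simp]: "\<not> ranked_before [] x y"
  by (simp add: ranked_before_def)

lemma ranked_before_in_set: "ranked_before l x y \<Longrightarrow> x \<in> set l \<and> y \<in> set l"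
  unfolding ranked_before_def by auto

lemma ranked_before_asym: "distinct l \<Longrightarrow> ranked_before l x y \<Longrightarrow> \<not> ranked_before l y x"
  by (induction l) (auto simp: ranked_before_Cons dest: ranked_before_in_set)

lemma ranked_before_irrefl: "distinct l \<Longrightarrow> \<not> ranked_before l x x"
  by (induction l) (auto simp: ranked_before_Cons)

lemma ranked_before_trans:
  "distinct l \<Longrightarrow> ranked_before l x y \<Longrightarrow> ranked_before l y z \<Longrightarrow> ranked_before l x z"
  by (induction l) (auto simp: ranked_before_Cons dest: ranked_before_in_set)

lemma ranked_before_total:
  "x \<in> set l \<Longrightarrow> y \<in> set l \<Longrightarrow> x \<noteq> y \<Longrightarrow> ranked_before l x y \<or> ranked_before l y x"
  by (induction l) (auto simp: ranked_before_Cons)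

lemma ranked_before_append:
  "x \<in> set l \<Longrightarrow> y \<in> set l' \<Longrightarrow> ranked_before (l @ l') x y"
  by (induction l) (auto simp: ranked_before_Cons)

lemma prob_draw_list_le:
  assumes "set_pmf D \<inter> A \<noteq> {}"
    and "\<And>q. q \<in> A \<Longrightarrow> q \<in> set_pmf D \<Longrightarrow>
      measure_pmf.prob (draw_list D (A - {q})) {l. P (q # l)} \<le> g q"
  shows "measure_pmf.prob (draw_list D A) {l. P l} \<le> (\<Sum>q\<in>A. pmf D q * g q) / measure_pmf.prob D A"
proof -
  have "measure_pmf.prob (draw_list D A) {l. P l} \<le> (\<Sum>x\<in>UNIV. pmf (cond_pmf D A) x * g x)"
    using assms
    by (subst draw_list.simps) (auto intro!: prob_bind_pmf_le assms(2) simp: vimage_def set_cond_pmf[OF assms(1)])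
  then show ?thesis by (simp add: sum_pmf_cond[OF assms(1)])
qed

text \<open>Only the first draw that hits \<open>x\<close> or \<open>y\<close> matters, and it hits
  \<open>y\<close> with conditional probability \<open>r\<close>. Induction on the draws: drawing
  \<open>x\<close> settles the question against \<open>y\<close>, drawing \<open>y\<close> concedes
  probability 1, any other draw leaves the bound \<open>r\<close>.\<close>

lemma prob_ranked_before_le:
  fixes D :: "'a::finite pmf"
  assumes "x \<in> A" "x \<noteq> y" "pmf D x > 0"
  shows "measure_pmf.prob (draw_list D A) {l. ranked_before l y x} \<le> pmf D y / (pmf D x + pmf D y)"
  using assms
proof (induction D A rule: draw_list.induct)
  case (1 D A)
  define r where "r = pmf D y / (pmf D x + pmf D y)"
  have r0: "r \<ge> 0" by (simp add: r_def)
  have xs: "x \<in> set_pmf D" using 1 by (simp add: set_pmf_iff)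
  then have ne: "set_pmf D \<inter> A \<noteq> {}" using 1 by auto
  define g where "g q = (if q = x then 0 else if q = y then 1 else r)" for q
  have "measure_pmf.prob (draw_list D A) {l. ranked_before l y x} \<le> (\<Sum>q\<in>A. pmf D q * g q) / measure_pmf.prob D A"
  proof (rule prob_draw_list_le[OF ne])
    fix q assume q: "q \<in> A" "q \<in> set_pmf D"
    show "measure_pmf.prob (draw_list D (A - {q})) {l. ranked_before (q # l) y x} \<le> g q"
    proof (cases "q = x")
      case True
      have "measure_pmf.prob (draw_list D (A - {q})) {l. ranked_before (q # l) y x}
            \<le> measure_pmf.prob (draw_list D (A - {q})) {}"
        by (rule prob_mono_pmf)
          (use True 1(3) in \<open>auto simp: ranked_before_Cons dest!: draw_list_support dest: ranked_before_in_set\<close>)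
      then show ?thesis using True by (simp add: g_def)
    next
      case False
      show ?thesis
      proof (cases "q = y")
        case True
        then show ?thesis using False by (simp add: g_def)
      next
        case F2: False
        have "measure_pmf.prob (draw_list D (A - {q})) {l. ranked_before l y x} \<le> r"
          unfolding r_def using 1(1)[OF ne, of q] 1 False q by (auto simp: set_cond_pmf[OF ne])
        then show ?thesis using False F2 by (simp add: g_def ranked_before_Cons)
      qed
    qed
  qed
  also have "\<dots> \<le> r"
  proof -
    have m: "measure_pmf.prob D A = (\<Sum>q\<in>A. pmf D q)"
      by (simp add: measure_measure_pmf_finite)
    have pos: "measure_pmf.prob D A > 0"
      using xs 1(2) by (rule measure_pmf_posI)
    have "(\<Sum>q\<in>A. pmf D q * g q) \<le> r * (\<Sum>q\<in>A. pmf D q)"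
    proof (cases "y \<in> A")
      case False
      then have "(\<Sum>q\<in>A. pmf D q * g q) \<le> (\<Sum>q\<in>A. r * pmf D q)"
        by (intro sum_mono) (auto simp: g_def r0)
      then show ?thesis by (simp add: sum_distrib_left)
    next
      case True
      define A' where "A' = A - {x, y}"
      have A: "A = insert x (insert y A')" "x \<notin> A'" "y \<notin> A'" "finite A'"
        using True 1(2) by (auto simp: A'_def)
      have "(\<Sum>q\<in>A'. pmf D q * g q) = r * (\<Sum>q\<in>A'. pmf D q)"
        unfolding sum_distrib_left by (intro sum.cong) (auto simp: g_def A'_def)
      moreover have "pmf D y = r * (pmf D x + pmf D y)"
      proof -
        have "pmf D x + pmf D y \<noteq> 0" using \<open>pmf D x > 0\<close> pmf_nonneg[of D y] by linarith
        then show ?thesis by (simp add: r_def)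
      qed
      ultimately show ?thesis using 1(3) A(2-)
        by (simp add: A(1) g_def algebra_simps)
    qed
    then show ?thesis using pos by (simp add: m pos_divide_le_eq)
  qed
  finally show ?case by (simp add: r_def)
qed

text \<open>Before each of the first \<open>k\<close> draws fewer than \<open>k\<close> persons are
  gone, so the remaining mass is at least \<open>\<tau>\<close> and \<open>x\<close> is drawn with
  probability at most \<open>pmf D x / \<tau>\<close>; these \<open>k\<close> chances add
  up.\<close>

lemma prob_take_le:
  fixes D :: "'a::finite pmf"
  assumes "\<tau> > 0" and "\<And>A'. A' \<subseteq> A \<Longrightarrow> card (A - A') < k \<Longrightarrow> \<tau> \<le> measure_pmf.prob D A'"
  shows "measure_pmf.prob (draw_list D A) {l. x \<in> set (take k l)} \<le> k * (pmf D x / \<tau>)"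
  using assms
proof (induction k arbitrary: A)
  case 0
  then show ?case by simp
next
  case (Suc k)
  show ?case
  proof (cases "set_pmf D \<inter> A = {}")
    case True
    then show ?thesis
      using \<open>\<tau> > 0\<close> by (subst draw_list.simps) (auto simp: indicator_def)
  next
    case ne: False
    define c where "c = k * (pmf D x / \<tau>)"
    have c0: "c \<ge> 0" using \<open>\<tau> > 0\<close> by (simp add: c_def)
    have t: "\<tau> \<le> measure_pmf.prob D A" using Suc(3)[of A] by simp
    have "measure_pmf.prob (draw_list D A) {l. x \<in> set (take (Suc k) l)}
        \<le> (\<Sum>q\<in>A. pmf D q * (if q = x then 1 + c else c)) / measure_pmf.prob D A"
    proof (rule prob_draw_list_le[OF ne])
      fix q assume q: "q \<in> A" "q \<in> set_pmf D"
      have "\<tau> \<le> measure_pmf.prob D A'" if "A' \<subseteq> A - {q}" "card (A - {q} - A') < k" for A'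
      proof (rule Suc(3))
        show "A' \<subseteq> A" using that by auto
        have "A - A' = insert q (A - {q} - A')" using that q by auto
        then have "card (A - A') \<le> Suc (card (A - {q} - A'))"
          by (simp add: card_insert_le_m1 card_insert_if)
        then show "card (A - A') < Suc k" using that by simp
      qed
      then have "measure_pmf.prob (draw_list D (A - {q})) {l. x \<in> set (take k l)} \<le> c"
        unfolding c_def by (rule Suc(1)[OF Suc(2)]) 
      moreover have "measure_pmf.prob (draw_list D (A - {q})) {l. x \<in> set (take (Suc k) (q # l))} \<le> 1" by simp
      ultimately show "measure_pmf.prob (draw_list D (A - {q})) {l. x \<in> set (take (Suc k) (q # l))}
          \<le> (if q = x then 1 + c else c)"
        using c0 by auto
    qed
    also have "(\<Sum>q\<in>A. pmf D q * (if q = x then 1 + c else c))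
        = (\<Sum>q\<in>A. (if q = x then pmf D x else 0) + c * pmf D q)"
      by (intro sum.cong) (auto simp: algebra_simps)
    also have "\<dots> = (if x \<in> A then pmf D x else 0) + c * measure_pmf.prob D A"
      by (simp add: sum.distrib sum_distrib_left[symmetric] measure_measure_pmf_finite)
    also have "\<dots> / measure_pmf.prob D A = (if x \<in> A then pmf D x else 0) / measure_pmf.prob D A + c"
      using t \<open>\<tau> > 0\<close> by (simp add: add_divide_distrib)
    also have "(if x \<in> A then pmf D x else 0) / measure_pmf.prob D A \<le> pmf D x / \<tau>"
      using t \<open>\<tau> > 0\<close> by (auto intro!: divide_left_mono mult_pos_pos)
    finally show ?thesis by (simp add: c_def algebra_simps add_divide_distrib)
  qed
qed

section \<open>Families of independent lists\<close>

lemma Pi_pmf_fun_upd: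
  fixes p :: "'a::finite \<Rightarrow> 'b pmf"
  shows "Pi_pmf UNIV d (p(x := q)) = bind_pmf q (\<lambda>y. map_pmf (\<lambda>f. f(x := y)) (Pi_pmf (UNIV - {x}) d p))"
proof -
  have "Pi_pmf (insert x (UNIV - {x})) d (p(x := q)) =
     bind_pmf q (\<lambda>y. map_pmf (\<lambda>f. f(x := y)) (Pi_pmf (UNIV - {x}) d (p(x := q))))"
    by (subst Pi_pmf_insert') (auto simp: map_pmf_def)
  also have "Pi_pmf (UNIV - {x}) d (p(x := q)) = Pi_pmf (UNIV - {x}) d p"
    by (rule Pi_pmf_cong) auto
  moreover have "insert x (UNIV - {x}) = UNIV" by auto
  ultimately show ?thesis by simp
qed

text \<open>Linearity of expectation: the left side is the expected number of \<open>x\<close> with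
  \<open>P l x\<close>. It replaces union bounds that would cost the number of all persons.\<close>

lemma sum_prob_le:
  fixes P :: "'b \<Rightarrow> 'a::finite \<Rightarrow> bool"
  assumes "\<And>l. l \<in> set_pmf p \<Longrightarrow> card {x. P l x} \<le> k"
  shows "(\<Sum>x\<in>UNIV. measure_pmf.prob p {l. P l x}) \<le> k"
proof -
  have "(\<Sum>x\<in>UNIV. measure_pmf.prob p {l. P l x})
      = (\<Sum>x\<in>UNIV. measure_pmf.expectation p (indicat_real {l. P l x}))"
    by simp
  also have "\<dots> = measure_pmf.expectation p (\<lambda>l. \<Sum>x\<in>UNIV. indicat_real {l. P l x} l)"
    by (rule Bochner_Integration.integral_sum[symmetric])
      (auto intro!: measure_pmf.integrable_const_bound[where B = 1] simp: indicator_def)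
  also have "\<dots> \<le> measure_pmf.expectation p (\<lambda>l. real k)"
  proof (rule integral_mono_AE)
    show "integrable (measure_pmf p) (\<lambda>l. \<Sum>x\<in>UNIV. indicat_real {l. P l x} l)"
      by (intro Bochner_Integration.integrable_sum measure_pmf.integrable_const_bound[where B = 1])
        (auto simp: indicator_def)
    have "(\<Sum>x\<in>UNIV. indicat_real {l. P l x} l) = card {x. P l x}" for l
      unfolding card_eq_sum of_nat_sum
      by (rule sum.mono_neutral_cong_right) (auto simp: indicator_def)
    then show "AE l in p. (\<Sum>x\<in>UNIV. indicat_real {l. P l x} l) \<le> k"
      using assms by (simp add: AE_measure_pmf_iff)
  qed simp
  finally show ?thesis by simp
qed

lemma prob_pair_pmf:
  "measure_pmf.prob (pair_pmf p q) {(x, y). P x y} =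
    measure_pmf.expectation p (\<lambda>x. measure_pmf.prob q {y. P x y})"
proof -
  have "pair_pmf p q = bind_pmf p (\<lambda>x. map_pmf (Pair x) q)"
    by (simp add: pair_pmf_def map_pmf_def)
  then show ?thesis by (simp add: prob_bind_pmf vimage_def)
qed

text \<open>Independence of coordinate \<open>x\<close> from an event that ignores it. The factor
  \<open>c\<close> is identified by taking for \<open>P\<close> the property that always
  holds.\<close>

lemma prob_Pi_pmf_component:
  fixes p :: "'a::finite \<Rightarrow> 'b pmf"
  assumes "\<And>f y. E (f(x := y)) \<longleftrightarrow> E f"
  shows "measure_pmf.prob (Pi_pmf UNIV d p) {f. E f \<and> P (f x)} =
    measure_pmf.prob (Pi_pmf UNIV d p) {f. E f} * measure_pmf.prob (p x) {y. P y}"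
proof -
  define c where "c = measure_pmf.prob (Pi_pmf (UNIV - {x}) d p) {f. E f}"
  have eq: "measure_pmf.prob (Pi_pmf UNIV d p) {f. E f \<and> P (f x)} = c * measure_pmf.prob (p x) {y. P y}" for P
  proof -
    have "Pi_pmf UNIV d p = Pi_pmf UNIV d (p(x := p x))" by simp
    then have "measure_pmf.prob (Pi_pmf UNIV d p) {f. E f \<and> P (f x)} = measure_pmf.expectation (p x)
        (\<lambda>y. measure_pmf.prob (Pi_pmf (UNIV - {x}) d p) {f. E f \<and> P y})"
      by (simp only: Pi_pmf_fun_upd prob_bind_pmf) (simp add: vimage_def assms)
    also have "(\<lambda>y. measure_pmf.prob (Pi_pmf (UNIV - {x}) d p) {f. E f \<and> P y}) =
        (\<lambda>y. c * indicator {y. P y} y)"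
      by (auto simp: fun_eq_iff c_def indicator_def)
    finally show ?thesis by simp
  qed
  show ?thesis using eq[of P] eq[of "\<lambda>_. True"] by simp
qed

lemma Pi_pmf_bind_component:
  fixes p :: "'a::finite \<Rightarrow> 'b pmf"
  assumes "p x = bind_pmf c (\<lambda>v. map_pmf (h v) (q v))"
  shows "Pi_pmf UNIV d p = bind_pmf c (\<lambda>v. map_pmf (\<lambda>L. L(x := h v (L x))) (Pi_pmf UNIV d (p(x := q v))))"
proof -
  have "Pi_pmf UNIV d p = Pi_pmf UNIV d (p(x := p x))" by simp
  also have "\<dots> = bind_pmf c (\<lambda>v. bind_pmf (q v) (\<lambda>y. map_pmf (\<lambda>f. f(x := h v y)) (Pi_pmf (UNIV - {x}) d p)))"
    unfolding assms Pi_pmf_fun_upd by (simp add: bind_assoc_pmf bind_map_pmf)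
  also have "\<dots> = bind_pmf c (\<lambda>v. map_pmf (\<lambda>L. L(x := h v (L x))) (Pi_pmf UNIV d (p(x := q v))))"
    unfolding Pi_pmf_fun_upd by (simp add: map_bind_pmf pmf.map_comp o_def)
  finally show ?thesis .
qed

text \<open>The principle of deferred decisions: only the head of the list of \<open>x\<close> is revealed.\<close>
lemma prob_reveal_le:
  fixes D :: "'m::finite \<Rightarrow> 'w::finite pmf"
  assumes ne: "set_pmf (D x) \<inter> A x \<noteq> {}"
    and le: "\<And>v. v \<in> A x \<Longrightarrow>
      measure_pmf.prob (Pi_pmf UNIV [] (\<lambda>m. draw_list (D m) ((A(x := A x - {v})) m))) {L. P (L(x := v # L x))} \<le> g v"
  shows "measure_pmf.prob (Pi_pmf UNIV [] (\<lambda>m. draw_list (D m) (A m))) {L. P L}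
     \<le> (\<Sum>v\<in>A x. pmf (D x) v * g v) / measure_pmf.prob (D x) (A x)"
proof -
  have eq: "(\<lambda>m. draw_list (D m) (A m))(x := draw_list (D x) (A x - {v})) =
      (\<lambda>m. draw_list (D m) ((A(x := A x - {v})) m))" for v
    by auto
  have "Pi_pmf UNIV [] (\<lambda>m. draw_list (D m) (A m)) = bind_pmf (cond_pmf (D x) (A x))
     (\<lambda>v. map_pmf (\<lambda>L. L(x := v # L x)) (Pi_pmf UNIV [] (\<lambda>m. draw_list (D m) ((A(x := A x - {v})) m))))"
    by (subst Pi_pmf_bind_component[where x = x and c = "cond_pmf (D x) (A x)" and h = "(#)"
          and q = "\<lambda>v. draw_list (D x) (A x - {v})"])
      (simp add: draw_list.simps[of "D x" "A x"] ne, simp only: eq)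
  then have "measure_pmf.prob (Pi_pmf UNIV [] (\<lambda>m. draw_list (D m) (A m))) {L. P L}
     \<le> (\<Sum>v\<in>UNIV. pmf (cond_pmf (D x) (A x)) v * g v)"
    using le[unfolded fun_upd_def] by (auto intro!: prob_bind_pmf_le simp: vimage_def set_cond_pmf[OF ne] fun_upd_def)
  then show ?thesis by (simp add: sum_pmf_cond[OF ne])
qed


subsection \<open>Deferred acceptance without a given woman\<close>

text \<open>The men in \<open>Q\<close> wait for their turn, the head proposes next; a jilted man takes the place of
  the man who displaced him.  The origin \<open>b\<close> is the man whose first turn started the current chain
  of proposals.  The woman \<open>w0\<close> turns down everybody.\<close>
definition respond ::
  "'w \<Rightarrow> ('w \<Rightarrow> 'm list) \<Rightarrow> 'm \<Rightarrow> 'm \<Rightarrow> 'm list \<Rightarrow> ('w \<Rightarrow> 'm option) \<Rightarrow> 'w \<Rightarrow> 'm \<times> 'm list \<times> ('w \<Rightarrow> 'm option)"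
  where
  "respond w0 PW b x Q f v =
     (if v = w0 then (b, x # Q, f)
      else case f v of
        None \<Rightarrow> (hd Q, Q, f(v := Some x))
      | Some y \<Rightarrow> if ranked_before (PW v) x y then (b, y # Q, f(v := Some x)) else (b, x # Q, f))"

function da ::
  "'w \<Rightarrow> ('w \<Rightarrow> 'm list) \<Rightarrow> 'm \<Rightarrow> 'm list \<Rightarrow> ('m::finite \<Rightarrow> 'w list) \<Rightarrow> ('w \<Rightarrow> 'm option) \<Rightarrow>
    ('m \<times> 'm \<times> 'w) list \<times> ('m \<Rightarrow> 'w list) \<times> ('w \<Rightarrow> 'm option)"
  where
  "da w0 PW b [] L f = ([], L, f)"
| "da w0 PW b (x # Q) L f =
     (case L x of
        [] \<Rightarrow> da w0 PW (hd Q) Q L f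
      | v # l \<Rightarrow> (case respond w0 PW b x Q f v of (b', Q', f') \<Rightarrow>
          apfst (Cons (b, x, v)) (da w0 PW b' Q' (L(x := l)) f')))"
  by pat_completeness auto
termination
proof (relation "Wellfounded.measure (\<lambda>(w0, PW, b, Q, L, f). (\<Sum>m\<in>UNIV. length (L m)) + length Q)", goal_cases)
  case (3 w0 PW b x Q L f v l b' y Q' f')
  have "(\<Sum>m\<in>UNIV. length ((L(x := l)) m)) < (\<Sum>m\<in>UNIV. length (L m))"
    by (rule sum_strict_mono_ex1) (use 3 in auto)
  moreover have "length Q' \<le> Suc (length Q)"
    using 3 by (auto simp: respond_def split: if_splits option.splits)
  ultimately show ?case using 3 by simp
qed auto

abbreviation "proposals w0 PW b Q L f \<equiv> set (fst (da w0 PW b Q L f))"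

text \<open>\<open>A m\<close> is the set of women to whom \<open>m\<close> has not yet proposed.\<close>
definition da_inv ::
  "'w \<Rightarrow> ('w \<Rightarrow> 'm list) \<Rightarrow> 'm set \<Rightarrow> 'm list \<Rightarrow> ('m \<Rightarrow> 'w set) \<Rightarrow> ('w \<Rightarrow> 'm option) \<Rightarrow> bool"
  where
  "da_inv w0 PW Y Q A f \<longleftrightarrow>
     distinct Q \<and> set Q \<subseteq> Y \<and> ran f \<subseteq> Y \<and> set Q \<inter> ran f = {} \<and> f w0 = None \<and>
     (\<forall>v v' m. f v = Some m \<longrightarrow> f v' = Some m \<longrightarrow> v = v') \<and>
     (\<forall>v m. f v = Some m \<longrightarrow> v \<notin> A m) \<and>
     (\<forall>m\<in>Y. \<forall>v. v \<notin> A m \<longrightarrow> v \<noteq> w0 \<longrightarrow> (\<exists>y. f v = Some y \<and> (y = m \<or> ranked_before (PW v) y m)))"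

lemma da_inv_pop: "da_inv w0 PW Y (x # Q) A f \<Longrightarrow> da_inv w0 PW Y Q A f"
  by (auto simp: da_inv_def)

lemma da_inv_init: "distinct Q \<Longrightarrow> set Q \<subseteq> Y \<Longrightarrow> da_inv w0 PW Y Q (\<lambda>m. UNIV) Map.empty"
  by (auto simp: da_inv_def)

text \<open>The invariant is about sets \<open>A\<close> rather than lists so that it serves twice:
  with \<open>A m = set (L m)\<close> for given lists, and in \<open>climbing\<close> while the rest
  of the lists is still undrawn.\<close>

lemma da_inv_respond:
  assumes inv: "da_inv w0 PW Y (x # Q) A f" and r: "respond w0 PW b x Q f v = (b', Q', f')"
    and v: "v \<in> A x" and PW: "distinct (PW v)" "set (PW v) = Y"
  shows "da_inv w0 PW Y Q' (A(x := A x - {v})) f'"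
proof -
  have x: "x \<in> Y" "x \<notin> ran f" "x \<notin> set Q" and
    i: "distinct Q" "set Q \<subseteq> Y" "ran f \<subseteq> Y" "set Q \<inter> ran f = {}" "f w0 = None"
      "\<And>v v' m. f v = Some m \<Longrightarrow> f v' = Some m \<Longrightarrow> v = v'"
      "\<And>v m. f v = Some m \<Longrightarrow> v \<notin> A m"
      "\<And>m v. m \<in> Y \<Longrightarrow> v \<notin> A m \<Longrightarrow> v \<noteq> w0 \<Longrightarrow> \<exists>y. f v = Some y \<and> (y = m \<or> ranked_before (PW v) y m)"
    using inv by (auto simp: da_inv_def)
  have xf: "f v' \<noteq> Some x" for v' using x by (auto simp: ran_def)
  show ?thesis
  proof (cases "v = w0")
    case True
    then show ?thesis using inv r
      by (auto simp: da_inv_def respond_def) 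
  next
    case v0: False
    show ?thesis
    proof (cases "f v")
      case None
      then have [simp]: "b' = hd Q" "Q' = Q" "f' = f(v := Some x)"
        using r v0 by (auto simp: respond_def)
      have "ran f' = insert x (ran f)" using None by simp
      \<comment> \<open>A free woman has not yet had a proposal from anybody in \<open>Y\<close>, so
        the last clause of the invariant is new at \<open>v\<close> only for \<open>x\<close>
        himself.\<close>
      moreover have "v \<in> A z" if "z \<in> Y" for z
        using i(8)[OF that, of v] v0 None by auto
      ultimately show ?thesis unfolding da_inv_def
        using i x v0 xf None by (auto split: if_splits)
    next
      case (Some y)
      have yY: "y \<in> Y" "y \<notin> set Q" "y \<noteq> x" using Some i x xf by (auto intro: ranI)
      show ?thesis
      proof (cases "ranked_before (PW v) x y")
        case True
        then have [simp]: "b' = b" "Q' = y # Q" "f' = f(v := Some x)"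
          using r v0 Some by (auto simp: respond_def)
        have "ran f' \<subseteq> insert x (ran f)" by (auto simp: ran_def)
        moreover have "y \<notin> ran f'" using yY i(6)[OF Some] by (auto simp: ran_def)
        moreover have "z = x \<or> ranked_before (PW v) x z" if "z \<in> Y" "v \<notin> A z" for z
          using i(8)[OF that v0] Some True ranked_before_trans[OF PW(1) True] by auto
        ultimately show ?thesis unfolding da_inv_def
          using i x v0 xf yY i(8) by (auto split: if_splits)
      next
        case False
        then have [simp]: "b' = b" "Q' = x # Q" "f' = f"
          using r v0 Some by (auto simp: respond_def)
        have "ranked_before (PW v) y x"
          using ranked_before_total[of x "PW v" y] False yY x PW by auto
        then show ?thesis unfolding da_inv_def
          using i x xf yY Some i(8) by (auto split: if_splits)
      qed
    qed
  qed
qed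

lemma set_lists_upd: "distinct (L x) \<Longrightarrow> L x = v # l \<Longrightarrow>
    (\<lambda>m. set ((L(x := l)) m)) = (\<lambda>m. set (L m))(x := set (L x) - {v})"
  by (auto simp: fun_eq_iff)

text \<open>\<open>PM\<close> are the full lists, \<open>L\<close> their unused parts.\<close>
definition suffixes :: "('m \<Rightarrow> 'w list) \<Rightarrow> ('m \<Rightarrow> 'w list) \<Rightarrow> bool" where
  "suffixes PM L \<longleftrightarrow> (\<forall>m. \<exists>p. PM m = p @ L m)"

lemma suffixes_upd: "suffixes PM L \<Longrightarrow> L x = v # l \<Longrightarrow> suffixes PM (L(x := l))"
  unfolding suffixes_def
proof
  fix m assume s: "\<forall>m. \<exists>p. PM m = p @ L m" and l: "L x = v # l"
  from s obtain p where p: "PM m = p @ L m" by blast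
  show "\<exists>p. PM m = p @ (L(x := l)) m"
    using p l by (cases "m = x") (auto intro: exI[of _ "p @ [v]"])
qed

lemma ranked_before_suffix:
  assumes "suffixes PM L" "u \<in> set (PM m)" "u \<notin> set (L m)" "v \<in> set (L m)"
  shows "ranked_before (PM m) u v"
proof -
  obtain p where "PM m = p @ L m" using assms by (auto simp: suffixes_def)
  then show ?thesis using assms by (auto intro: ranked_before_append)
qed

lemma ranked_before_hd_suffix:
  assumes "suffixes PM L" "L m = u # l" "v \<in> set l"
  shows "ranked_before (PM m) u v"
proof -
  obtain p where "PM m = p @ L m" using assms(1) unfolding suffixes_def by blast
  then have "PM m = (p @ [u]) @ l" using assms(2) by simp
  then show ?thesis using assms by (auto simp del: append_assoc intro: ranked_before_append)
qed

lemma suffixes_distinct: "suffixes PM L \<Longrightarrow> distinct (PM m) \<Longrightarrow> distinct (L m)"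
  by (metis distinct_append suffixes_def)

lemma da_final:
  assumes "da w0 PW b Q L f = (tr, L', f')"
    and "\<And>v. distinct (PW v)" "\<And>v. set (PW v) = Y" "\<And>m. distinct (L m)"
    and "da_inv w0 PW Y Q (\<lambda>m. set (L m)) f"
    and "\<And>m. m \<in> Y - set Q - ran f \<Longrightarrow> L m = []"
  shows "da_inv w0 PW Y [] (\<lambda>m. set (L' m)) f'" (is ?inv)
    and "\<And>m. m \<in> Y - ran f' \<Longrightarrow> L' m = []" (is "PROP ?exh")
    and "suffixes PM L \<Longrightarrow> suffixes PM L'" (is "_ \<Longrightarrow> ?suf")
    and "set (L m) = set (L' m) \<union> {v. \<exists>b. (b, m, v) \<in> set tr}" (is ?tr)
    and "{v. \<exists>b m. (b, m, v) \<in> set tr} \<subseteq> insert w0 (dom f')" (is ?hit)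
    and "dom f \<subseteq> dom f'" (is ?dom)
proof -
  have "?inv \<and> (\<forall>m. m \<in> Y - ran f' \<longrightarrow> L' m = []) \<and> (suffixes PM L \<longrightarrow> ?suf) \<and>
      (\<forall>m. set (L m) = set (L' m) \<union> {v. \<exists>b. (b, m, v) \<in> set tr}) \<and> ?hit \<and> ?dom"
    using assms
  proof (induction w0 PW b Q L f arbitrary: tr rule: da.induct)
    case (1 w0 PW b L f)
    then show ?case by auto
  next
    case (2 w0 PW b x Q L f)
    show ?case
    proof (cases "L x")
      case Nil
      have "L m = []" if "m \<in> Y - set Q - ran f" for m
        using 2(8)[of m] Nil that by (cases "m = x") auto
      from 2(1)[OF Nil _ 2(4-6) da_inv_pop[OF 2(7)] this, of tr] show ?thesis
        using 2(3) Nil by simp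
    next
      case (Cons v l)
      obtain b' Q' f1 where r: "respond w0 PW b x Q f v = (b', Q', f1)" by (metis prod_cases3)
      obtain tr' where tr: "da w0 PW b' Q' (L(x := l)) f1 = (tr', L', f')" "tr = (b, x, v) # tr'"
        using 2(3) Cons r by (cases "da w0 PW b' Q' (L(x := l)) f1") auto
      have eq: "(\<lambda>m. set ((L(x := l)) m)) = (\<lambda>m. set (L m))(x := set (L x) - {v})"
        by (rule set_lists_upd[of L x v l]) (use 2(6)[of x] Cons in simp_all)
      have inv: "da_inv w0 PW Y Q' (\<lambda>m. set ((L(x := l)) m)) f1"
        unfolding eq by (rule da_inv_respond[OF 2(7) r]) (use 2(4,5) Cons in simp_all)
      have d: "distinct ((L(x := l)) m)" for m
        using 2(6)[of m] 2(6)[of x] Cons by simp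
      have dom: "dom f \<subseteq> dom f1" "v \<in> insert w0 (dom f1)"
        using r by (auto simp: respond_def split: if_splits option.splits)
      have "set Q' \<union> ran f1 = insert x (set Q \<union> ran f)"
        using r 2(7) by (auto simp: respond_def da_inv_def ran_def split: if_splits option.splits; metis option.inject)
      then have ex: "m \<in> Y - set Q' - ran f1 \<Longrightarrow> (L(x := l)) m = []" for m
        using 2(8)[of m] by auto
      have "da_inv w0 PW Y [] (\<lambda>m. set (L' m)) f' \<and> (\<forall>m. m \<in> Y - ran f' \<longrightarrow> L' m = []) \<and>
         (suffixes PM (L(x := l)) \<longrightarrow> suffixes PM L') \<and>
         (\<forall>m. set ((L(x := l)) m) = set (L' m) \<union> {v. \<exists>b. (b, m, v) \<in> set tr'}) \<and>
         {v. \<exists>b m. (b, m, v) \<in> set tr'} \<subseteq> insert w0 (dom f') \<and> dom f1 \<subseteq> dom f'"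
        by (rule 2(2)[OF Cons r[symmetric] refl tr(1) 2(4,5) d inv ex])
      then have I: "da_inv w0 PW Y [] (\<lambda>m. set (L' m)) f'" "(\<forall>m. m \<in> Y - ran f' \<longrightarrow> L' m = [])"
         "suffixes PM (L(x := l)) \<Longrightarrow> suffixes PM L'"
         "\<And>m. set ((L(x := l)) m) = set (L' m) \<union> {v. \<exists>b. (b, m, v) \<in> set tr'}"
         "{v. \<exists>b m. (b, m, v) \<in> set tr'} \<subseteq> insert w0 (dom f')" "dom f1 \<subseteq> dom f'"
        by blast+
      have "set (L m) = set (L' m) \<union> {v. \<exists>b. (b, m, v) \<in> set tr}" for m
        using I(4)[of m] Cons tr(2) by (cases "m = x") auto
      moreover have "{v. \<exists>b m. (b, m, v) \<in> set tr} \<subseteq> insert w0 (dom f')"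
        using I(5,6) dom tr(2) by auto
      moreover have "suffixes PM L \<Longrightarrow> suffixes PM L'"
        using I(3) suffixes_upd[of PM L x v l] Cons by simp
      moreover have "dom f \<subseteq> dom f'" using dom(1) I(6) by (rule subset_trans)
      ultimately show ?thesis using I(1,2) by (intro conjI allI impI) simp_all
    qed
  qed
  then show ?inv "PROP ?exh" "suffixes PM L \<Longrightarrow> ?suf" ?tr ?hit ?dom by blast+
qed

text \<open>The list of a free woman is not consulted before her first proposal, and that proposal
  already decides the claim.\<close>

lemma hit_cong:
  assumes "\<And>u. u \<noteq> v \<Longrightarrow> PW u = PW' u" "f v = None"
  shows "(\<exists>b m. (b, m, v) \<in> proposals w0 PW b0 Q L f) \<longleftrightarrow> (\<exists>b m. (b, m, v) \<in> proposals w0 PW' b0 Q L f)"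
  using assms
proof (induction w0 PW b0 Q L f rule: da.induct)
  case (1 w0 PW b L f)
  then show ?case by simp
next
  case (2 w0 PW b x Q L f)
  show ?case
  proof (cases "L x")
    case Nil
    then show ?thesis using 2(1)[OF Nil 2(3,4)] by simp
  next
    case (Cons u l)
    obtain b' Q' f1 where r: "respond w0 PW b x Q f u = (b', Q', f1)" by (metis prod_cases3)
    show ?thesis
    proof (cases "u = v")
      case True
      then show ?thesis using Cons by (auto simp: case_prod_beta)
    next
      case False
      have r': "respond w0 PW' b x Q f u = (b', Q', f1)"
        using r by (simp only: respond_def 2(3)[OF False])
      have "f1 v = None"
        using r False 2(4) by (auto simp: respond_def split: if_splits option.splits)
      with 2(2)[OF Cons r[symmetric] refl 2(3)] show ?thesis
        using Cons r r' False by (simp add: fun_upd_def)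
    qed
  qed
qed

text \<open>Jilted men re-enter only at the head, so a later origin must have stood in the tail from
  the start.\<close>

lemma origin_in_queue:
  "(b', m, v) \<in> proposals w0 PW b Q L f \<Longrightarrow> Q \<noteq> [] \<Longrightarrow> b' = b \<or> b' \<in> set (tl Q)"
proof (induction w0 PW b Q L f rule: da.induct)
  case (1 w0 PW b L f)
  then show ?case by simp
next
  case (2 w0 PW b x Q L f)
  show ?case
  proof (cases "L x")
    case Nil
    then show ?thesis using 2(1)[OF Nil] 2(3) by (cases Q) auto
  next
    case (Cons u l)
    obtain b1 Q' f1 where r: "respond w0 PW b x Q f u = (b1, Q', f1)" by (metis prod_cases3)
    have "b' = b \<or> (b', m, v) \<in> proposals w0 PW b1 Q' (L(x := l)) f1"
      using 2(3) Cons r by auto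
    then show ?thesis
    proof
      assume *: "(b', m, v) \<in> proposals w0 PW b1 Q' (L(x := l)) f1"
      then have "Q' \<noteq> []" by auto
      then have "b' = b1 \<or> b' \<in> set (tl Q')"
        using 2(2)[OF Cons r[symmetric] refl *] by blast
      with r \<open>Q' \<noteq> []\<close> show ?thesis
        by (cases Q) (auto simp: respond_def split: if_splits option.splits)
    qed auto
  qed
qed


subsection \<open>Comparing two stable matchings\<close>

lemma stable_matchingD:
  assumes "stable_matching PM PW \<mu>"
  shows "(m, v) \<in> \<mu> \<Longrightarrow> (m, v') \<in> \<mu> \<Longrightarrow> v = v'"
    and "(m, v) \<in> \<mu> \<Longrightarrow> (m', v) \<in> \<mu> \<Longrightarrow> m = m'"
    and "(m, v) \<in> \<mu> \<Longrightarrow> v \<in> set (PM m)"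
    and "(m, v) \<in> \<mu> \<Longrightarrow> m \<in> set (PW v)"
    and "prefers_to_partner (PM m) v (\<mu> `` {m}) \<Longrightarrow> \<not> prefers_to_partner (PW v) m (\<mu>\<inverse> `` {v})"
proof -
  have s: "single_valued \<mu>" "single_valued (\<mu>\<inverse>)"
    and a: "\<forall>(m, w)\<in>\<mu>. w \<in> set (PM m) \<and> m \<in> set (PW w)"
    and b: "\<not> (\<exists>m w. prefers_to_partner (PM m) w (\<mu> `` {m}) \<and> prefers_to_partner (PW w) m (\<mu>\<inverse> `` {w}))"
    using assms by (auto simp: stable_matching_def is_matching_def)
  show "(m, v) \<in> \<mu> \<Longrightarrow> (m, v') \<in> \<mu> \<Longrightarrow> v = v'" using s(1) by (auto dest: single_valuedD)
  show "(m, v) \<in> \<mu> \<Longrightarrow> (m', v) \<in> \<mu> \<Longrightarrow> m = m'" using s(2) by (auto dest: single_valuedD)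
  show "(m, v) \<in> \<mu> \<Longrightarrow> v \<in> set (PM m)" "(m, v) \<in> \<mu> \<Longrightarrow> m \<in> set (PW v)" using a by auto
  show "prefers_to_partner (PM m) v (\<mu> `` {m}) \<Longrightarrow> \<not> prefers_to_partner (PW v) m (\<mu>\<inverse> `` {v})"
    using b by blast
qed

lemma stable_no_block:
  assumes st: "stable_matching PM PW \<mu>"
    and m: "v \<in> set (PM m)" "\<And>u. (m, u) \<in> \<mu> \<Longrightarrow> ranked_before (PM m) v u"
    and v: "m \<in> set (PW v)" "\<And>y. (y, v) \<in> \<mu> \<Longrightarrow> ranked_before (PW v) m y"
  shows False
proof -
  have "prefers_to_partner (PM m) v (\<mu> `` {m})" "prefers_to_partner (PW v) m (\<mu>\<inverse> `` {v})"
    using m v by (auto simp: prefers_to_partner_def)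
  with stable_matchingD(5)[OF st] show False by blast
qed

text \<open>On the set of men who prefer \<open>\<nu>\<close> to the stable matching \<open>\<mu>\<close>, sending a man to the
  \<open>\<mu>\<close>-husband of his \<open>\<nu>\<close>-wife is an injection, hence a bijection.\<close>
lemma preferring_men_matched:
  fixes \<mu> :: "('m::finite \<times> 'w) set"
  assumes st: "stable_matching PM PW \<mu>" and dPM: "\<And>m. distinct (PM m)"
    and nu: "is_matching \<nu>" "\<And>m u. (m, u) \<in> \<nu> \<Longrightarrow> m \<in> set (PW u)"
    and block: "\<And>m u m2. (m, u) \<in> \<nu> \<Longrightarrow> (m2, u) \<in> \<mu> \<Longrightarrow> ranked_before (PW u) m2 m \<Longrightarrow>
        \<exists>u2. (m2, u2) \<in> \<nu> \<and> ranked_before (PM m2) u2 u"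
    and m: "(m, u) \<in> \<nu>" "u \<in> set (PM m)" "\<And>u'. (m, u') \<in> \<mu> \<Longrightarrow> ranked_before (PM m) u u'"
  shows "\<exists>u'. (m, u') \<in> \<mu> \<and> u' \<in> Range \<nu>"
proof -
  define P where "P = {m. \<exists>u. (m, u) \<in> \<nu> \<and> u \<in> set (PM m) \<and> (\<forall>u'. (m, u') \<in> \<mu> \<longrightarrow> ranked_before (PM m) u u')}"
  have ex: "\<exists>m2 u. (x, u) \<in> \<nu> \<and> (m2, u) \<in> \<mu> \<and> m2 \<in> P" if xP: "x \<in> P" for x
  proof -
    have "\<exists>u. (x, u) \<in> \<nu> \<and> u \<in> set (PM x) \<and> (\<forall>u'. (x, u') \<in> \<mu> \<longrightarrow> ranked_before (PM x) u u')"
      using xP by (simp add: P_def)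
    then obtain u where u: "(x, u) \<in> \<nu>" "u \<in> set (PM x)" "\<forall>u'. (x, u') \<in> \<mu> \<longrightarrow> ranked_before (PM x) u u'"
      by blast
    \<comment> \<open>Otherwise \<open>x\<close> and \<open>u\<close> would block
      \<open>\<mu>\<close>. So \<open>u\<close> has a \<open>\<mu>\<close>-husband whom she prefers
      to \<open>x\<close>, and \<open>block\<close> shows that he too prefers his wife in
      \<open>\<nu>\<close>.\<close>
    have "\<not> (\<forall>y. (y, u) \<in> \<mu> \<longrightarrow> ranked_before (PW u) x y)"
    proof
      assume *: "\<forall>y. (y, u) \<in> \<mu> \<longrightarrow> ranked_before (PW u) x y"
      show False
        by (rule stable_no_block[OF st u(2) u(3)[rule_format] nu(2)[OF u(1)] *[rule_format]])
    qed
    then obtain m2 where m2: "(m2, u) \<in> \<mu>" "\<not> ranked_before (PW u) x m2"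
      by blast
    have "m2 \<noteq> x"
    proof
      assume "m2 = x"
      with m2(1) u(3) have "ranked_before (PM x) u u" by simp
      then show False using ranked_before_irrefl[OF dPM] by simp
    qed
    then have "ranked_before (PW u) m2 x"
      using ranked_before_total[OF nu(2)[OF u(1)] stable_matchingD(4)[OF st m2(1)]] m2(2) by blast
    from block[OF u(1) m2(1) this] obtain u2 where "(m2, u2) \<in> \<nu>" "ranked_before (PM m2) u2 u" by blast
    moreover have "u' = u" if "(m2, u') \<in> \<mu>" for u'
      using stable_matchingD(1)[OF st that m2(1)] .
    ultimately have "m2 \<in> P" by (auto simp: P_def dest: ranked_before_in_set)
    then show ?thesis using u(1) m2(1) by (intro exI[of _ m2] exI[of _ u] conjI)
  qed
  then have "\<forall>x\<in>P. \<exists>m2. \<exists>u. (x, u) \<in> \<nu> \<and> (m2, u) \<in> \<mu> \<and> m2 \<in> P" by simp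
  from bchoice[OF this] obtain g where g: "\<forall>x\<in>P. \<exists>u. (x, u) \<in> \<nu> \<and> (g x, u) \<in> \<mu> \<and> g x \<in> P" ..
  have "inj_on g P"
  proof (rule inj_onI)
    fix x y assume xy: "x \<in> P" "y \<in> P" "g x = g y"
    obtain u u' where u: "(x, u) \<in> \<nu>" "(g x, u) \<in> \<mu>" and u': "(y, u') \<in> \<nu>" "(g y, u') \<in> \<mu>"
      using g xy by blast
    have "u = u'" using stable_matchingD(1)[OF st u(2)] u'(2) xy(3) by simp
    with u u' show "x = y" using nu(1) by (auto simp: is_matching_def dest: single_valuedD)
  qed
  moreover have "g ` P \<subseteq> P" using g by blast
  ultimately have "g ` P = P" by (intro endo_inj_surj) auto
  moreover have "m \<in> P" using m by (auto simp: P_def)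
  ultimately have "m \<in> g ` P" by simp
  then obtain m' where "m = g m'" "m' \<in> P" by (rule imageE)
  with g obtain u where "(m', u) \<in> \<nu>" "(m, u) \<in> \<mu>" by blast
  then show ?thesis by blast
qed

text \<open>One part of the rural hospitals theorem: a man single in \<open>\<mu>\<close> vacuously
  prefers \<open>\<nu>\<close>, so \<open>preferring_men_matched\<close> would give him a wife in
  \<open>\<mu>\<close>. Its condition \<open>block\<close> holds because \<open>m2\<close> and
  \<open>u\<close> would otherwise block \<open>\<nu>\<close>.\<close>

lemma stable_men_same:
  fixes \<mu> \<nu> :: "('m::finite \<times> 'w) set"
  assumes st: "stable_matching PM PW \<mu>" "stable_matching PM PW \<nu>" and dPM: "\<And>m. distinct (PM m)"
    and dPW: "\<And>v. distinct (PW v)" and m: "(m, u) \<in> \<nu>"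
  shows "m \<in> Domain \<mu>"
proof (rule ccontr)
  assume n: "m \<notin> Domain \<mu>"
  have "\<exists>u'. (m, u') \<in> \<mu> \<and> u' \<in> Range \<nu>"
  proof (rule preferring_men_matched[OF st(1) dPM _ _ _ m])
    show "is_matching \<nu>" using st(2) by (simp add: stable_matching_def)
    fix m u assume mu: "(m, u) \<in> \<nu>"
    show "m \<in> set (PW u)" by (rule stable_matchingD(4)[OF st(2) mu])
    fix m2 assume m2: "(m2, u) \<in> \<mu>" "ranked_before (PW u) m2 m"
    have "u \<in> set (PM m2)" by (rule stable_matchingD(3)[OF st(1) m2(1)])
    show "\<exists>u2. (m2, u2) \<in> \<nu> \<and> ranked_before (PM m2) u2 u"
    proof (rule ccontr)
      assume no: "\<not> ?thesis"
      show False
      proof (rule stable_no_block[OF st(2), of u m2])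
        show "u \<in> set (PM m2)" by fact
        show "m2 \<in> set (PW u)" by (rule stable_matchingD(4)[OF st(1) m2(1)])
        fix u' assume u': "(m2, u') \<in> \<nu>"
        have "m \<noteq> m2" using m2(2) ranked_before_irrefl[OF dPW] by blast
        then have "u' \<noteq> u" using u' mu stable_matchingD(2)[OF st(2)] by blast
        then show "ranked_before (PM m2) u u'"
          using ranked_before_total[OF \<open>u \<in> set (PM m2)\<close> stable_matchingD(3)[OF st(2) u']] no u' by blast
      next
        fix y assume "(y, u) \<in> \<nu>"
        then have "y = m" using stable_matchingD(2)[OF st(2) mu] by blast
        then show "ranked_before (PW u) m2 y" using m2 by simp
      qed
    qed
  qed (use n stable_matchingD(3)[OF st(2) m] in auto)
  with n show False by blast
qed


text \<open>If \<open>h\<close> never reached \<open>w0\<close>, he would end engaged to a woman he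
  prefers to \<open>w0\<close>. Comparing \<open>\<mu>\<close> with the final engagements
  \<open>\<nu>\<close>, his \<open>\<mu>\<close>-wife \<open>w0\<close> would be engaged in
  \<open>\<nu>\<close>, but she turns down everybody.\<close>

lemma stable_husband_proposes:
  fixes PM :: "'m::finite \<Rightarrow> 'w list"
  assumes st: "stable_matching PM PW \<mu>" and h: "(h, w0) \<in> \<mu>"
    and dPM: "\<And>m. distinct (PM m)" and sPM: "\<And>m. set (PM m) = UNIV"
    and PW: "\<And>v. distinct (PW v)" "\<And>v. set (PW v) = Y" and Q: "distinct Q" "set Q = Y"
  shows "\<exists>b. (b, h, w0) \<in> proposals w0 PW b0 Q PM Map.empty"
proof (rule ccontr)
  assume no: "\<not> ?thesis"
  obtain tr L f where da: "da w0 PW b0 Q PM Map.empty = (tr, L, f)" by (metis prod_cases3)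
  have inv0: "da_inv w0 PW Y Q (\<lambda>m. set (PM m)) Map.empty"
    unfolding sPM by (rule da_inv_init) (use Q in auto)
  have ex0: "m \<in> Y - set Q - ran Map.empty \<Longrightarrow> PM m = []" for m using Q by simp
  note fin = da_final[OF da PW dPM inv0 ex0]
  have suf: "suffixes PM L" by (rule fin(3)) (auto simp: suffixes_def)
  have inv: "set Q \<subseteq> Y" "ran f \<subseteq> Y" "f w0 = None"
    "\<And>v v' m. f v = Some m \<Longrightarrow> f v' = Some m \<Longrightarrow> v = v'"
    "\<And>v m. f v = Some m \<Longrightarrow> v \<notin> set (L m)"
    "\<And>m v. m \<in> Y \<Longrightarrow> v \<notin> set (L m) \<Longrightarrow> v \<noteq> w0 \<Longrightarrow> \<exists>y. f v = Some y \<and> (y = m \<or> ranked_before (PW v) y m)"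
    using fin(1) Q by (auto simp: da_inv_def)
  have hY: "h \<in> Y" using stable_matchingD(4)[OF st h] PW by simp
  have better: "\<exists>u. f u = Some m \<and> ranked_before (PM m) u v" if "m \<in> Y" "v \<in> set (L m)" for m v
  proof -
    have "L m \<noteq> []" using that by auto
    then have "m \<in> ran f" using fin(2)[of m] that by blast
    then obtain u where u: "f u = Some m" by (auto simp: ran_def)
    then have "ranked_before (PM m) u v"
      using ranked_before_suffix[OF suf _ inv(5)[OF u] that(2)] sPM by simp
    with u show ?thesis by blast
  qed
  have "w0 \<in> set (L h)" using fin(4)[of h] no da by (auto simp: sPM)
  from better[OF hY this] obtain u where u: "f u = Some h" "ranked_before (PM h) u w0" by blast
  define \<nu> where "\<nu> = {(m, u). f u = Some m}"
  have "\<exists>u'. (h, u') \<in> \<mu> \<and> u' \<in> Range \<nu>"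
  proof (rule preferring_men_matched[OF st dPM])
    show "is_matching \<nu>"
      using inv(4) by (auto simp: is_matching_def \<nu>_def single_valued_def)
    show "m \<in> set (PW u)" if "(m, u) \<in> \<nu>" for m u
      using that inv(2) PW by (auto simp: \<nu>_def ran_def)
    show "(h, u) \<in> \<nu>" using u by (simp add: \<nu>_def)
    show "u \<in> set (PM h)" by (simp add: sPM)
    show "ranked_before (PM h) u u'" if "(h, u') \<in> \<mu>" for u'
      using stable_matchingD(1)[OF st that h] u by simp
    fix m u m2 assume a: "(m, u) \<in> \<nu>" "(m2, u) \<in> \<mu>" "ranked_before (PW u) m2 m"
    have f: "f u = Some m" using a by (simp add: \<nu>_def)
    then have u0: "u \<noteq> w0" using inv(3) by auto
    have m2: "m2 \<in> Y" using stable_matchingD(4)[OF st a(2)] PW by simp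
    have "u \<in> set (L m2)"
    proof (rule ccontr)
      assume "u \<notin> set (L m2)"
      from inv(6)[OF m2 this u0] f have "m = m2 \<or> ranked_before (PW u) m m2" by auto
      then show False using a(3) ranked_before_irrefl[OF PW(1)] ranked_before_asym[OF PW(1)] by blast
    qed
    from better[OF m2 this] show "\<exists>u2. (m2, u2) \<in> \<nu> \<and> ranked_before (PM m2) u2 u"
      by (auto simp: \<nu>_def)
  qed
  then obtain u' where "(h, u') \<in> \<mu>" "u' \<in> Range \<nu>" by blast
  then have "w0 \<in> Range \<nu>" using stable_matchingD(1)[OF st h] by blast
  then show False using inv(3) by (auto simp: \<nu>_def)
qed

text \<open>As long as \<open>h\<close>, the \<open>\<mu>\<close>-husband of \<open>w0\<close>, waits for his turn, nobody is turned down by his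
  \<open>\<mu>\<close>-wife.\<close>
definition no_partner_lost :: "('m \<times> 'w) set \<Rightarrow> ('m \<Rightarrow> 'w list) \<Rightarrow> ('w \<Rightarrow> 'm option) \<Rightarrow> bool" where
  "no_partner_lost \<mu> L f \<longleftrightarrow> (\<forall>m v. (m, v) \<in> \<mu> \<longrightarrow> v \<notin> set (L m) \<longrightarrow> f v = Some m)"

text \<open>The first violation yields a pair blocking \<open>\<mu>\<close>. If \<open>v\<close>
  gives up her \<open>\<mu>\<close>-husband for \<open>x\<close>, the pair is \<open>x\<close> and
  \<open>v\<close>; if she refuses her \<open>\<mu>\<close>-husband \<open>x\<close> for
  \<open>y\<close>, it is \<open>y\<close> and \<open>v\<close>; if \<open>w0\<close> prefers
  \<open>x\<close> to the waiting \<open>h\<close>, it is \<open>x\<close> and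
  \<open>w0\<close>.\<close>

lemma no_partner_lost_respond:
  assumes st: "stable_matching PM PW \<mu>" and h: "(h, w0) \<in> \<mu>"
    and dPM: "\<And>m. distinct (PM m)" and sPM: "\<And>m. set (PM m) = UNIV"
    and PW: "\<And>v. distinct (PW v)" "\<And>v. set (PW v) = Y"
    and suf: "suffixes PM L" and inv: "da_inv w0 PW Y (x # Q) (\<lambda>m. set (L m)) f"
    and lost: "no_partner_lost \<mu> L f" and hQ: "h \<in> set Q"
    and L: "L x = v # l" and r: "respond w0 PW b x Q f v = (b', Q', f')"
  shows "no_partner_lost \<mu> (L(x := l)) f'"
    and "v = w0 \<Longrightarrow> \<not> ranked_before (PW w0) x h"
proof -
  have i: "f w0 = None" "\<And>v v' m. f v = Some m \<Longrightarrow> f v' = Some m \<Longrightarrow> v = v'"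
      "\<And>v m. f v = Some m \<Longrightarrow> v \<notin> set (L m)" "x \<noteq> h" "x \<in> Y" "\<And>v. f v \<noteq> Some x" "ran f \<subseteq> Y"
    using inv hQ by (auto simp: da_inv_def ran_def)
  have lost': "\<And>m v. (m, v) \<in> \<mu> \<Longrightarrow> v \<notin> set (L m) \<Longrightarrow> f v = Some m"
    using lost by (auto simp: no_partner_lost_def)
  \<comment> \<open>As \<open>x\<close> is not engaged, he has not yet proposed to his
    \<open>\<mu>\<close>-wife; she is \<open>v\<close> or comes later on his list.\<close>
  have x_unused: "ranked_before (PM x) v u" if "(x, u) \<in> \<mu>" "u \<noteq> v" for u
  proof -
    have "u \<in> set (L x)" using lost'[OF that(1)] i(6) by blast
    then have "u \<in> set l" using L that by simp
    then show ?thesis by (rule ranked_before_hd_suffix[OF suf L])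
  qed
  show "\<not> ranked_before (PW w0) x h" if v: "v = w0"
  proof
    assume rb: "ranked_before (PW w0) x h"
    show False
    proof (rule stable_no_block[OF st, of w0 x])
      fix u assume u: "(x, u) \<in> \<mu>"
      have "u \<noteq> w0" using stable_matchingD(2)[OF st u] h i(4) by blast
      with x_unused[OF u] v show "ranked_before (PM x) w0 u" by simp
    next
      fix y assume "(y, w0) \<in> \<mu>"
      then have "y = h" using stable_matchingD(2)[OF st _ h] by blast
      then show "ranked_before (PW w0) x y" using rb by simp
    qed (use i PW sPM in auto)
  qed
  have other: "f u = Some m" if "(m, u) \<in> \<mu>" "u \<notin> set ((L(x := l)) m)" "(m, u) \<noteq> (x, v)" for m u
    using lost'[OF that(1)] that L by (auto split: if_splits)
  show "no_partner_lost \<mu> (L(x := l)) f'"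
  proof (cases "v = w0")
    case True
    then have "(x, v) \<notin> \<mu>" using stable_matchingD(2)[OF st _ h] i(4) by blast
    moreover have "f' = f" using True r by (simp add: respond_def)
    ultimately show ?thesis unfolding no_partner_lost_def using other by metis
  next
    case v0: False
    show ?thesis
    proof (cases "f v")
      case None
      then have f': "f' = f(v := Some x)" using r v0 by (simp add: respond_def)
      show ?thesis unfolding no_partner_lost_def
      proof (intro allI impI)
        fix m u assume a: "(m, u) \<in> \<mu>" "u \<notin> set ((L(x := l)) m)"
        show "f' u = Some m"
          using other[OF a] f' None by (cases "(m, u) = (x, v)") auto
      qed
    next
      case (Some y)
      have yx: "y \<noteq> x" using Some i(6) by auto
      have yY: "y \<in> Y" using Some i(7) by (auto simp: ran_def)
      show ?thesis
      proof (cases "ranked_before (PW v) x y")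
        case True
        then have f': "f' = f(v := Some x)" using r v0 Some by (simp add: respond_def)
        have yv: "(y, v) \<notin> \<mu>"
        proof
          assume yv: "(y, v) \<in> \<mu>"
          show False
          proof (rule stable_no_block[OF st, of v x])
            fix u assume u: "(x, u) \<in> \<mu>"
            have "u \<noteq> v" using stable_matchingD(2)[OF st u] yv yx by blast
            with x_unused[OF u] show "ranked_before (PM x) v u" by simp
          next
            fix z assume "(z, v) \<in> \<mu>"
            then have "z = y" using stable_matchingD(2)[OF st _ yv] by blast
            then show "ranked_before (PW v) x z" using True by simp
          qed (use i PW sPM in auto)
        qed
        show ?thesis unfolding no_partner_lost_def
        proof (intro allI impI)
          fix m u assume a: "(m, u) \<in> \<mu>" "u \<notin> set ((L(x := l)) m)"
          show "f' u = Some m"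
            using other[OF a] f' Some yv a by (cases "(m, u) = (x, v)") auto
        qed
      next
        case False
        then have f': "f' = f" using r v0 Some by (simp add: respond_def)
        have rb: "ranked_before (PW v) y x"
          using ranked_before_total[of x "PW v" y] False i yY yx PW by auto
        have xv: "(x, v) \<notin> \<mu>"
        proof
          assume xv: "(x, v) \<in> \<mu>"
          show False
          proof (rule stable_no_block[OF st, of v y])
            fix u assume u: "(y, u) \<in> \<mu>"
            have "u \<noteq> v" using stable_matchingD(2)[OF st u] xv yx by blast
            have "u \<in> set (L y)"
              using lost'[OF u] i(2)[OF Some, of u] \<open>u \<noteq> v\<close> by blast
            then show "ranked_before (PM y) v u"
              using ranked_before_suffix[OF suf _ i(3)[OF Some]] sPM by simp
          next
            fix z assume "(z, v) \<in> \<mu>"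
            then have "z = x" using stable_matchingD(2)[OF st _ xv] by blast
            then show "ranked_before (PW v) y z" using rb by simp
          qed (use yY PW sPM in auto)
        qed
        show ?thesis unfolding no_partner_lost_def
        proof (intro allI impI)
          fix m u assume a: "(m, u) \<in> \<mu>" "u \<notin> set ((L(x := l)) m)"
          show "f' u = Some m"
            using other[OF a] f' xv a by (cases "(m, u) = (x, v)") auto
        qed
      qed
    qed
  qed
qed

text \<open>While \<open>h\<close> waits, nobody whom \<open>w0\<close> prefers to \<open>h\<close>
  proposes to her. So \<open>h'\<close> does so only after the first turn of \<open>h\<close>, when
  every origin is \<open>h\<close> or somebody behind him in the sorted queue.\<close>

lemma origin_after:
  fixes lev :: "'m::finite \<Rightarrow> nat"
  assumes "(b', h', w0) \<in> proposals w0 PW b Q L f"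
    and st: "stable_matching PM PW \<mu>" and h: "(h, w0) \<in> \<mu>"
    and dPM: "\<And>m. distinct (PM m)" and sPM: "\<And>m. set (PM m) = UNIV"
    and PW: "\<And>v. distinct (PW v)" "\<And>v. set (PW v) = Y"
    and "suffixes PM L" and "da_inv w0 PW Y Q (\<lambda>m. set (L m)) f"
    and "no_partner_lost \<mu> L f"
    and rb: "ranked_before (PW w0) h' h"
    and "h \<in> set (tl Q)" and "sorted_wrt (\<lambda>x y. lev y \<le> lev x) (tl Q)"
  shows "lev b' \<le> lev h"
  using assms
proof (induction w0 PW b Q L f rule: da.induct)
  case (1 w0 PW b L f)
  then show ?case by simp
next
  case (2 w0 PW b x Q L f)
  note prem = 2(3-)
  have hQ: "h \<in> set Q" and sQ: "sorted_wrt (\<lambda>x y. lev y \<le> lev x) Q" using prem by auto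
  then obtain q Q1 where Q: "Q = q # Q1" by (cases Q) auto
  have turn: "lev b' \<le> lev h" if "q = h" "(b', h', w0) \<in> proposals w0 PW (hd Q) Q L1 f1" for L1 f1
    using origin_in_queue[OF that(2)] that(1) sQ Q by auto
  show ?case
  proof (cases "L x")
    case Nil
    then have p: "(b', h', w0) \<in> proposals w0 PW (hd Q) Q L f" using prem(1) by simp
    show ?thesis
    proof (cases "q = h")
      case True
      then show ?thesis using turn p by blast
    next
      case False
      show ?thesis
        by (rule 2(1)[OF Nil p prem(2-8) da_inv_pop[OF prem(9)] prem(10,11)]) (use hQ sQ Q False in auto)
    qed
  next
    case (Cons v l)
    obtain b1 Q' f1 where r: "respond w0 PW b x Q f v = (b1, Q', f1)" by (metis prod_cases3)
    note np = no_partner_lost_respond[OF prem(2-9) prem(10) hQ Cons r]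
    have "(b', h', w0) \<noteq> (b, x, v)" using np(2) prem(11) by auto
    then have p: "(b', h', w0) \<in> proposals w0 PW b1 Q' (L(x := l)) f1"
      using prem(1) Cons r by auto
    have dL: "distinct (L x)" using suffixes_distinct[OF prem(8)] prem(4) by blast
    have inv: "da_inv w0 PW Y Q' (\<lambda>m. set ((L(x := l)) m)) f1"
      unfolding set_lists_upd[of L x v l, OF dL Cons]
      by (rule da_inv_respond[OF prem(9) r]) (use prem(6,7) Cons in simp_all)
    have "(b1 = hd Q \<and> Q' = Q) \<or> tl Q' = Q"
      using r by (auto simp: respond_def split: if_splits option.splits)
    then consider "q = h" "b1 = hd Q" "Q' = Q" | "h \<in> set (tl Q')" "sorted_wrt (\<lambda>x y. lev y \<le> lev x) (tl Q')"
      using hQ sQ Q by auto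
    then show ?thesis
    proof cases
      case 1
      then show ?thesis using turn p by blast
    next
      case 2
      show ?thesis
        by (rule "2.IH"(2)[OF Cons r[symmetric] refl p prem(2-7) suffixes_upd[of PM L x v l, OF prem(8) Cons] inv np(1) prem(11) 2])
    qed
  qed
qed


subsection \<open>Climbing is unlikely\<close>

text \<open>An injection of \<open>A\<close> into \<open>B\<close> allows a comparison term by
  term.\<close>

lemma sum_le_if_card_le:
  fixes g :: "'a \<Rightarrow> real"
  assumes "finite A" "finite B" "card A \<le> card B" "R \<ge> 0"
    and "\<And>a b. a \<in> A \<Longrightarrow> b \<in> B \<Longrightarrow> g a \<le> R * g b" and "\<And>b. b \<in> B \<Longrightarrow> g b \<ge> 0"
  shows "sum g A \<le> R * sum g B"
proof -
  obtain i where i: "i ` A \<subseteq> B" "inj_on i A"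
    using card_le_inj[OF assms(1-3)] by blast
  have "sum g A \<le> (\<Sum>a\<in>A. R * g (i a))"
    using i by (intro sum_mono assms(5)) auto
  also have "\<dots> = R * sum g (i ` A)"
    using i by (simp add: sum.reindex sum_distrib_left)
  also have "\<dots> \<le> R * sum g B"
    using i assms by (intro mult_left_mono sum_mono2) auto
  finally show ?thesis .
qed

text \<open>A chain with an origin of level at most \<open>a\<close> climbs to level \<open>a + j + 1\<close> one level at a time.
  On levels above \<open>a\<close> each man who proposes is more likely than \<open>1 / (1 + R)\<close> to fall below level
  \<open>a\<close> before he displaces anybody of level at least \<open>a\<close>.  The women outside \<open>G\<close> may have arbitrary
  preferences.\<close>
locale climbing =
  fixes DM :: "'m::finite \<Rightarrow> 'w::finite pmf" and PW :: "'w \<Rightarrow> 'm list" and w0 :: 'w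
    and Y :: "'m set" and lev :: "'m \<Rightarrow> nat" and G :: "'w set" and R :: real and a j n :: nat
  assumes full: "\<And>m. set_pmf (DM m) = UNIV"
    and PW: "\<And>v. distinct (PW v)" "\<And>v. set (PW v) = Y"
    and good: "\<And>v x y. v \<in> G \<Longrightarrow> x \<in> Y \<Longrightarrow> y \<in> Y \<Longrightarrow> lev y + 2 \<le> lev x \<Longrightarrow> ranked_before (PW v) x y"
    and R: "R > 0" "\<And>m u v. pmf (DM m) u \<le> R * pmf (DM m) v"
    and cell: "card {y \<in> Y. a \<le> lev y \<and> lev y \<le> a + j + 1} + card {y \<in> Y. a \<le> lev y} \<le> CARD('w) + 1"
    and n: "n = min (card Y) CARD('w)"
begin

text \<open>The ratio at which a climb by one level, gaining the fraction
  \<open>1 / p - 1 = 1 / R\<close> of the height, balances a fall that loses all of it and is at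
  least \<open>1 / R\<close> times as likely.\<close>

definition "p = R / (1 + R)"

text \<open>Including the condition on \<open>G\<close> in the event makes its probability 0 once a
  woman outside \<open>G\<close> is asked, so only women in \<open>G\<close> need to be
  analysed.\<close>

definition climbs :: "('m \<times> 'm \<times> 'w) list \<Rightarrow> bool" where
  "climbs tr \<longleftrightarrow> (\<exists>(b, x, v) \<in> set tr. lev b \<le> a \<and> a + j + 1 \<le> lev x) \<and> (\<forall>(b, x, v) \<in> set tr. v \<in> G)"

text \<open>Bounds the number of future proposals that can start a climb.\<close>
definition starts :: "('m \<Rightarrow> 'w set) \<Rightarrow> nat" where
  "starts A = (\<Sum>m | m \<in> Y \<and> lev m = a. n - 1 - card (UNIV - A m - {w0}))"

text \<open>The potential of a chain that has already left level \<open>a\<close>: one factor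
  \<open>p\<close> for each level missing. Truncated subtraction makes it 1 from level
  \<open>a + j + 1\<close> on. Together with \<open>starts\<close> times \<open>p ^ j\<close> it
  forms a supermartingale.\<close>

definition height :: "'m \<Rightarrow> 'm list \<Rightarrow> real" where
  "height b Q = (if Q \<noteq> [] \<and> lev b \<le> a \<and> a + 1 \<le> lev (hd Q) then p ^ (a + j + 1 - lev (hd Q)) else 0)"

lemma p: "0 < p" "p < 1" "1 / p - 1 = 1 / R"
  using R(1) by (auto simp: p_def field_simps)

lemma height_nonneg: "height b Q \<ge> 0"
  using p by (simp add: height_def)

lemma height_turn: "height (hd Q) Q = 0"
  by (simp add: height_def)

lemma starts_mono: "starts (A(x := A x - {v})) \<le> starts A"
  unfolding starts_def by (intro sum_mono diff_le_mono2 card_mono) auto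

lemma rank_level:
  assumes "v \<in> G" "x \<in> Y" "y \<in> Y" "ranked_before (PW v) x y"
  shows "lev y \<le> lev x + 1"
  using good[OF assms(1,3,2)] ranked_before_asym[OF PW(1) assms(4)] by force

text \<open>The women other than \<open>w0\<close> whom \<open>x\<close> has asked before are all
  engaged, and so is the new \<open>v\<close>; as \<open>x\<close> himself is not engaged and
  \<open>w0\<close> never is, there are at most \<open>n - 1\<close> engaged women. Hence the
  summand of \<open>x\<close> is still positive and drops without truncation.\<close>

lemma starts_decreases:
  assumes inv: "da_inv w0 PW Y (x # Q) A f" and v: "v \<in> A x" "f v = Some y" and x: "lev x = a"
  shows "starts (A(x := A x - {v})) + 1 \<le> starts A"
proof -
  have i: "x \<in> Y" "ran f \<subseteq> Y" "x \<notin> ran f" "f w0 = None"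
    "\<And>v v' m. f v = Some m \<Longrightarrow> f v' = Some m \<Longrightarrow> v = v'"
    using inv by (auto simp: da_inv_def)
  have used: "v \<in> dom f" if "v \<notin> A x" "v \<noteq> w0" for v
    using inv that i(1) unfolding da_inv_def by blast
  define C where "C = UNIV - A x - {w0}"
  have vC: "v \<notin> C" "insert v C \<subseteq> dom f" "UNIV - (A x - {v}) - {w0} = insert v C"
    using v i(4) used by (auto simp: C_def)
  have "card (dom f) = card (ran f)"
  proof -
    have "ran f = (\<lambda>u. the (f u)) ` dom f" by (force simp: ran_def image_iff)
    moreover have "inj_on (\<lambda>u. the (f u)) (dom f)" using i(5) by (auto simp: inj_on_def)
    ultimately show ?thesis by (simp add: card_image)
  qed
  also have "\<dots> \<le> card (Y - {x})" by (rule card_mono) (use i in auto)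
  finally have "card (dom f) \<le> card Y - 1" using i by simp
  moreover have "card (dom f) \<le> card (UNIV - {w0})"
    by (rule card_mono) (use i in auto)
  ultimately have "card (dom f) \<le> n - 1" by (simp add: n)
  then have "card (insert v C) \<le> n - 1" using card_mono[OF _ vC(2)] by simp
  then have c: "Suc (card C) \<le> n - 1" using vC(1) by simp
  have "starts A = (n - 1 - card C) + (\<Sum>m | m \<in> Y \<and> lev m = a \<and> m \<noteq> x. n - 1 - card (UNIV - A m - {w0}))"
    unfolding starts_def
    by (subst sum.remove[of _ x]) (use i x in \<open>auto simp: C_def intro!: sum.cong\<close>)
  moreover have "starts (A(x := A x - {v})) =
      (n - 1 - card (insert v C)) + (\<Sum>m | m \<in> Y \<and> lev m = a \<and> m \<noteq> x. n - 1 - card (UNIV - A m - {w0}))"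
    unfolding starts_def
    by (subst sum.remove[of _ x]) (use i x vC(3) in \<open>auto intro!: sum.cong\<close>)
  ultimately show ?thesis using c vC(1) by simp
qed

text \<open>One step of the supermartingale, when the active man has climbed.\<close>
lemma sum_height_le:
  assumes inv: "da_inv w0 PW Y (x # Q) A f" and G: "dom f \<subseteq> G"
    and b: "lev b \<le> a" and x: "a + 1 \<le> lev x" "lev x \<le> a + j"
    and h: "\<And>v. h v = (case respond w0 PW b x Q f v of (b', Q', f') \<Rightarrow> height b' Q')"
  shows "(\<Sum>v\<in>A x. pmf (DM x) v * h v) \<le> (\<Sum>v\<in>A x. pmf (DM x) v) * height b (x # Q)"
proof -
  define e where "e = height b (x # Q)"
  have i: "x \<in> Y" "ran f \<subseteq> Y" "x \<notin> ran f" "f w0 = None"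
    "\<And>v v' m. f v = Some m \<Longrightarrow> f v' = Some m \<Longrightarrow> v = v'"
    "\<And>v. v \<notin> A x \<Longrightarrow> v \<noteq> w0 \<Longrightarrow> \<exists>y. f v = Some y \<and> (y = x \<or> ranked_before (PW v) y x)"
    using inv by (auto simp: da_inv_def)
  have e: "e = p ^ (a + j + 1 - lev x)" "e > 0" using b x p by (simp_all add: e_def height_def)
  have "a + j + 1 - lev x = Suc (a + j - lev x)" using x by simp
  then have ep: "e / p = p ^ (a + j - lev x)" using p by (simp add: e(1))
  \<comment> \<open>A proposal to \<open>Lw\<close> is accepted and reduces the height to 0; one to
    \<open>Mw\<close> gains at most \<open>e / R\<close>; any other leaves \<open>e\<close>. The
    threshold is \<open>lev y < a\<close> since \<open>x\<close> has level at least
    \<open>a + 1\<close> and \<open>good\<close> needs a gap of two.\<close>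
  define Lw where "Lw = {v. v \<noteq> w0 \<and> (\<forall>y. f v = Some y \<longrightarrow> lev y < a)}"
  define Mw where "Mw = {v. \<exists>y. f v = Some y \<and> a \<le> lev y \<and> ranked_before (PW v) x y}"
  have disj: "Lw \<inter> Mw = {}" by (auto simp: Lw_def Mw_def)
  have fY: "y \<in> Y" if "f v = Some y" for v y using that i by (auto simp: ran_def)
  have fG: "v \<in> G" if "f v = Some y" for v y using that G by auto
  have accept: "ranked_before (PW v) x y" if "f v = Some y" "lev y < a" for v y
    using good[OF fG[OF that(1)] i(1) fY[OF that(1)]] that x by simp
  \<comment> \<open>All of \<open>Lw\<close> is still available to \<open>x\<close>: a woman he
    asked before holds him or somebody she prefers, while those in \<open>Lw\<close> would accept
    him.\<close>
  have LA: "Lw \<subseteq> A x"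
  proof
    fix v assume v: "v \<in> Lw"
    show "v \<in> A x"
    proof (rule ccontr)
      assume "v \<notin> A x"
      with i(6) v obtain y where y: "f v = Some y" "y = x \<or> ranked_before (PW v) y x"
        by (auto simp: Lw_def)
      then have "ranked_before (PW v) x y" using accept v by (auto simp: Lw_def)
      with y show False
        using ranked_before_irrefl[OF PW(1)] ranked_before_asym[OF PW(1)] by blast
    qed
  qed
  have hv: "h v \<le> e + (if v \<in> Lw then - e else 0) + (if v \<in> Mw then e / R else 0)" for v
  proof (cases "v = w0")
    case True
    then have "h v = e" by (simp add: h respond_def e_def)
    then show ?thesis using True i(4) e R by (auto simp: Lw_def Mw_def)
  next
    case v0: False
    show ?thesis
    proof (cases "f v")
      case None
      then have "h v = 0" "v \<in> Lw" "v \<notin> Mw"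
        using v0 by (auto simp: h respond_def height_turn Lw_def Mw_def)
      then show ?thesis by simp
    next
      case (Some y)
      show ?thesis
      proof (cases "ranked_before (PW v) x y")
        case True
        then have hv: "h v = height b (y # Q)" using v0 Some by (simp add: h respond_def)
        show ?thesis
        proof (cases "lev y < a")
          case True
          then have "h v = 0" "v \<in> Lw" "v \<notin> Mw"
            using v0 Some by (auto simp: hv height_def Lw_def Mw_def)
          then show ?thesis by simp
        next
          case False
          have "lev y \<le> lev x + 1" by (rule rank_level[OF fG[OF Some] i(1) fY[OF Some] True])
          then have "p ^ (a + j + 1 - lev y) \<le> p ^ (a + j - lev x)"
            using p by (intro power_decreasing) auto
          moreover have "0 < p ^ (a + j - lev x)" using p by simp
          ultimately have "h v \<le> e / p" by (simp add: hv height_def ep)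
          also have "e / p = e + e * (1 / p - 1)" using p by (simp add: field_simps)
          also have "\<dots> = e + e / R" by (simp add: p(3))
          finally have "h v \<le> e + e / R" .
          moreover have "v \<notin> Lw" "v \<in> Mw"
            using Some False True by (auto simp: Lw_def Mw_def)
          ultimately show ?thesis by simp
        qed
      next
        case False
        then have "h v = e" using v0 Some by (simp add: h respond_def e_def)
        moreover have "v \<notin> Lw" "v \<notin> Mw"
          using Some accept False by (auto simp: Lw_def Mw_def)
        ultimately show ?thesis by simp
      qed
    qed
  qed
  \<comment> \<open>Women in \<open>Mw\<close> hold men of the interval other than \<open>x\<close>;
    women outside \<open>Lw\<close>, apart from \<open>w0\<close>, hold men of level at least
    \<open>a\<close> other than \<open>x\<close>. With these counts the inequality is exactly the
    assumption \<open>cell\<close>.\<close>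
  have "card Mw \<le> card Lw"
  proof -
    have inj: "inj_on (\<lambda>u. the (f u)) S" if "S \<subseteq> dom f" for S
      using i(5) that by (fastforce simp: inj_on_def)
    have "card Mw = card ((\<lambda>u. the (f u)) ` Mw)"
      by (rule card_image[symmetric], rule inj) (auto simp: Mw_def)
    also have "\<dots> \<le> card ({y \<in> Y. a \<le> lev y \<and> lev y \<le> a + j + 1} - {x})"
    proof (rule card_mono)
      show "(\<lambda>u. the (f u)) ` Mw \<subseteq> {y \<in> Y. a \<le> lev y \<and> lev y \<le> a + j + 1} - {x}"
      proof
        fix y assume "y \<in> (\<lambda>u. the (f u)) ` Mw"
        then obtain v where v: "f v = Some y" "a \<le> lev y" "ranked_before (PW v) x y"
          by (auto simp: Mw_def)
        have "lev y \<le> lev x + 1" by (rule rank_level[OF fG[OF v(1)] i(1) fY[OF v(1)] v(3)])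
        moreover have "y \<noteq> x" using v(1) i(3) by (auto simp: ran_def)
        ultimately show "y \<in> {y \<in> Y. a \<le> lev y \<and> lev y \<le> a + j + 1} - {x}"
          using v fY x by auto
      qed
    qed simp
    also have "\<dots> = card {y \<in> Y. a \<le> lev y \<and> lev y \<le> a + j + 1} - 1"
      using x i(1) by simp
    finally have M: "card Mw \<le> card {y \<in> Y. a \<le> lev y \<and> lev y \<le> a + j + 1} - 1" .
    have "card (- Lw - {w0}) = card ((\<lambda>u. the (f u)) ` (- Lw - {w0}))"
      by (rule card_image[symmetric], rule inj) (auto simp: Lw_def)
    also have "\<dots> \<le> card ({y \<in> Y. a \<le> lev y} - {x})"
    proof (rule card_mono)
      show "(\<lambda>u. the (f u)) ` (- Lw - {w0}) \<subseteq> {y \<in> Y. a \<le> lev y} - {x}"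
        using fY i(3) by (auto simp: Lw_def ran_def)
    qed simp
    also have "\<dots> = card {y \<in> Y. a \<le> lev y} - 1" using x i(1) by simp
    finally have L1: "card (- Lw - {w0}) \<le> card {y \<in> Y. a \<le> lev y} - 1" .
    have w0L: "w0 \<in> - Lw" by (simp add: Lw_def)
    then have "card (- Lw) \<noteq> 0" by auto
    moreover have "card (- Lw - {w0}) = card (- Lw) - 1" using w0L by simp
    moreover have "card (- Lw) = CARD('w) - card Lw" by (simp add: Compl_eq_Diff_UNIV card_Diff_subset)
    moreover have "card {y \<in> Y. a \<le> lev y} > 0" "card {y \<in> Y. a \<le> lev y \<and> lev y \<le> a + j + 1} > 0"
      using x i(1) by (auto simp: card_gt_0_iff intro!: exI[of _ x])
    ultimately show ?thesis using M L1 cell by linarith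
  qed
  then have "sum (pmf (DM x)) Mw \<le> R * sum (pmf (DM x)) Lw"
    by (intro sum_le_if_card_le R(2)) (use R in auto)
  moreover have "sum (pmf (DM x)) (A x \<inter> Mw) \<le> sum (pmf (DM x)) Mw"
    by (intro sum_mono2) auto
  ultimately have MR: "sum (pmf (DM x)) (A x \<inter> Mw) / R \<le> sum (pmf (DM x)) Lw"
    using R(1) by (simp add: field_simps)
  have "(\<Sum>v\<in>A x. pmf (DM x) v * h v)
      \<le> (\<Sum>v\<in>A x. pmf (DM x) v * (e + (if v \<in> Lw then - e else 0) + (if v \<in> Mw then e / R else 0)))"
    by (intro sum_mono mult_left_mono hv) auto
  also have "\<dots> = (\<Sum>v\<in>A x. pmf (DM x) v * e + (if v \<in> Lw then - e * pmf (DM x) v else 0)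
      + (if v \<in> Mw then (e / R) * pmf (DM x) v else 0))"
    by (intro sum.cong) (auto simp: algebra_simps)
  also have "\<dots> = (\<Sum>v\<in>A x. pmf (DM x) v) * e - e * sum (pmf (DM x)) (A x \<inter> Lw)
      + (e / R) * sum (pmf (DM x)) (A x \<inter> Mw)"
    by (simp only: sum.distrib sum_distrib_right[symmetric] sum.inter_restrict[symmetric, OF finite]
        sum_distrib_left[symmetric])
  also have "A x \<inter> Lw = Lw" using LA by blast
  also have "(\<Sum>v\<in>A x. pmf (DM x) v) * e - e * sum (pmf (DM x)) Lw + (e / R) * sum (pmf (DM x)) (A x \<inter> Mw)
      \<le> (\<Sum>v\<in>A x. pmf (DM x) v) * e"
    using mult_left_mono[OF MR, of e] e(2) by simp
  finally show ?thesis by (simp add: e_def)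
qed

text \<open>From a chain that is not climbing, positive height arises only when a man of level
  \<open>a\<close> displaces one of level \<open>a + 1\<close>. The new height \<open>p ^ j\<close>
  is paid by one unit of \<open>starts\<close>.\<close>

lemma height_respond_le:
  assumes inv: "da_inv w0 PW Y (x # Q) A f" and G: "dom f \<subseteq> G"
    and x: "\<not> (lev b \<le> a \<and> a + 1 \<le> lev x)" and v: "v \<in> A x"
    and r: "respond w0 PW b x Q f v = (b', Q', f')"
  shows "starts (A(x := A x - {v})) * p ^ j + height b' Q' \<le> starts A * p ^ j"
proof -
  have le: "real (starts (A(x := A x - {v}))) * p ^ j \<le> starts A * p ^ j"
    using starts_mono p by (intro mult_right_mono) auto
  show ?thesis
  proof (cases "height b' Q' = 0")
    case True
    then show ?thesis using le by simp
  next
    case False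
    then have b': "Q' \<noteq> []" "lev b' \<le> a" "a + 1 \<le> lev (hd Q')"
      by (auto simp: height_def split: if_splits)
    have "Q' \<noteq> x # Q \<or> b' \<noteq> b" using x b' by auto
    moreover have "\<not> (b' = hd Q \<and> Q' = Q)" using b' by auto
    ultimately obtain y where y: "f v = Some y" "ranked_before (PW v) x y" "b' = b" "Q' = y # Q"
      using r by (auto simp: respond_def split: if_splits option.splits)
    have "x \<in> Y" "y \<in> Y" "v \<in> G" using inv G y(1) by (auto simp: da_inv_def ran_def)
    then have "lev y \<le> lev x + 1" using rank_level y(2) by blast
    then have lv: "lev x = a" "lev y = a + 1" using x b' y by auto
    have "real (starts (A(x := A x - {v})) + 1) * p ^ j \<le> starts A * p ^ j"
      using starts_decreases[OF inv v y(1) lv(1)] p by (intro mult_right_mono) auto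
    moreover have "height b' Q' = p ^ j" using b' lv y by (simp add: height_def)
    ultimately show ?thesis by (simp add: algebra_simps)
  qed
qed

text \<open>The right side does not increase in the mean when the next woman is revealed, and it is
  at least 1 once the top is reached; induction over the run turns this into the bound.\<close>

lemma prob_climbs_le:
  assumes "da_inv w0 PW Y Q A f" "dom f \<subseteq> G"
  shows "measure_pmf.prob (Pi_pmf UNIV [] (\<lambda>m. draw_list (DM m) (A m))) {L. climbs (fst (da w0 PW b Q L f))}
    \<le> starts A * p ^ j + height b Q"
  using assms
proof (induction "(\<Sum>m\<in>UNIV. card (A m)) + length Q" arbitrary: b Q A f rule: less_induct)
  case less
  let ?P = "\<lambda>A. Pi_pmf UNIV [] (\<lambda>m. draw_list (DM m) (A m))"
  have V0: "real (starts A) * p ^ j \<ge> 0" using p by simp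
  show ?case
  proof (cases Q)
    case Nil
    then show ?thesis using V0 height_nonneg[of b Q] by (simp add: climbs_def)
  next
    case (Cons x Q1)
    have inv: "da_inv w0 PW Y (x # Q1) A f" using less(2) Cons by simp
    show ?thesis
    proof (cases "lev b \<le> a \<and> a + j + 1 \<le> lev x")
      case True
      then have "height b Q = 1" using Cons by (simp add: height_def)
      then show ?thesis using V0 by (auto intro: order_trans[OF measure_pmf.prob_le_1])
    next
      case low: False
      show ?thesis
      proof (cases "A x = {}")
        case True
        have "measure_pmf.prob (?P A) {L. climbs (fst (da w0 PW b Q L f))}
            \<le> measure_pmf.prob (?P A) {L. climbs (fst (da w0 PW (hd Q1) Q1 L f))}"
        proof (rule prob_mono_pmf)
          fix L assume L: "L \<in> set_pmf (?P A)" and c: "L \<in> {L. climbs (fst (da w0 PW b Q L f))}"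
          have "L x \<in> set_pmf (draw_list (DM x) (A x))"
            using L by (auto simp: set_Pi_pmf PiE_dflt_def)
          then have "L x = []" using True by (auto dest: draw_list_support)
          with c show "L \<in> {L. climbs (fst (da w0 PW (hd Q1) Q1 L f))}" by (simp add: Cons)
        qed
        also have "\<dots> \<le> starts A * p ^ j + height (hd Q1) Q1"
          by (rule less(1)) (use Cons less(3) da_inv_pop[OF inv] in auto)
        also have "\<dots> \<le> starts A * p ^ j + height b Q" using height_nonneg height_turn by simp
        finally show ?thesis .
      next
        case ne: False
        then have ne': "set_pmf (DM x) \<inter> A x \<noteq> {}" using full by auto
        define g where "g v = (case respond w0 PW b x Q1 f v of (b', Q', f') \<Rightarrow>
           starts (A(x := A x - {v})) * p ^ j + height b' Q')" for v
        define S where "S = (\<Sum>v\<in>A x. pmf (DM x) v)"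
        have S: "S = measure_pmf.prob (DM x) (A x)" by (simp add: S_def measure_measure_pmf_finite)
        have S0: "S > 0" unfolding S using ne' by (auto intro: measure_pmf_posI)
        have "measure_pmf.prob (?P A) {L. climbs (fst (da w0 PW b Q L f))}
           \<le> (\<Sum>v\<in>A x. pmf (DM x) v * g v) / measure_pmf.prob (DM x) (A x)"
        proof (rule prob_reveal_le[of DM x A "\<lambda>L. climbs (fst (da w0 PW b Q L f))" g, OF ne'])
          fix v assume v: "v \<in> A x"
          obtain b' Q' f' where r: "respond w0 PW b x Q1 f v = (b', Q', f')" by (metis prod_cases3)
          have gv: "g v = starts (A(x := A x - {v})) * p ^ j + height b' Q'" by (simp add: g_def r)
          have da: "fst (da w0 PW b Q (L(x := v # L x)) f) = (b, x, v) # fst (da w0 PW b' Q' L f')" for L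
            by (simp add: Cons r)
          show "measure_pmf.prob (?P (A(x := A x - {v}))) {L. climbs (fst (da w0 PW b Q (L(x := v # L x)) f))} \<le> g v"
          proof (cases "v \<in> G")
            case False
            then have "{L. climbs (fst (da w0 PW b Q (L(x := v # L x)) f))} = {}"
              unfolding da by (auto simp: climbs_def)
            then show ?thesis using gv p height_nonneg[of b' Q'] by simp
          next
            case True
            \<comment> \<open>By \<open>low\<close> the revealed proposal does not itself complete a
              climb.\<close>
            have "{L. climbs (fst (da w0 PW b Q (L(x := v # L x)) f))} \<subseteq> {L. climbs (fst (da w0 PW b' Q' L f'))}"
              unfolding da using low by (auto simp: climbs_def)
            then have "measure_pmf.prob (?P (A(x := A x - {v}))) {L. climbs (fst (da w0 PW b Q (L(x := v # L x)) f))}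
                \<le> measure_pmf.prob (?P (A(x := A x - {v}))) {L. climbs (fst (da w0 PW b' Q' L f'))}"
              by (intro measure_pmf.finite_measure_mono) auto
            also have "\<dots> \<le> starts (A(x := A x - {v})) * p ^ j + height b' Q'"
            proof (rule less(1))
              have "(\<Sum>m\<in>UNIV. card ((A(x := A x - {v})) m)) < (\<Sum>m\<in>UNIV. card (A m))"
                using v card_gt_0_iff[of "A x"] by (intro sum_strict_mono_ex1) auto
              moreover have "length Q' \<le> length Q"
                using r Cons by (auto simp: respond_def split: if_splits option.splits)
              ultimately show "(\<Sum>m\<in>UNIV. card ((A(x := A x - {v})) m)) + length Q' < (\<Sum>m\<in>UNIV. card (A m)) + length Q"
                by linarith
              show "da_inv w0 PW Y Q' (A(x := A x - {v})) f'"
                by (rule da_inv_respond[OF inv r v PW])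
              show "dom f' \<subseteq> G"
                using r True less(3) by (fastforce simp: respond_def split: if_splits option.splits)
            qed
            finally show ?thesis by (simp only: gv)
          qed
        qed
        also have "(\<Sum>v\<in>A x. pmf (DM x) v * g v) \<le> S * (starts A * p ^ j + height b Q)"
        proof (cases "lev b \<le> a \<and> a + 1 \<le> lev x")
          case True
          define h where "h v = (case respond w0 PW b x Q1 f v of (b', Q', f') \<Rightarrow> height b' Q')" for v
          have "g v \<le> starts A * p ^ j + h v" for v
            using starts_mono[of A x v] p by (auto simp: g_def h_def split: prod.split intro!: mult_right_mono)
          then have "(\<Sum>v\<in>A x. pmf (DM x) v * g v) \<le> (\<Sum>v\<in>A x. pmf (DM x) v * (starts A * p ^ j + h v))"
            by (intro sum_mono mult_left_mono) auto
          also have "\<dots> = S * (starts A * p ^ j) + (\<Sum>v\<in>A x. pmf (DM x) v * h v)"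
            by (simp add: S_def sum.distrib distrib_left sum_distrib_right)
          also have "(\<Sum>v\<in>A x. pmf (DM x) v * h v) \<le> S * height b Q"
            unfolding S_def Cons
            by (rule sum_height_le[OF inv less(3)]) (use True low in \<open>auto simp: h_def\<close>)
          finally show ?thesis by (simp add: algebra_simps)
        next
          case False
          have "g v \<le> starts A * p ^ j" if "v \<in> A x" for v
            using height_respond_le[OF inv less(3) False that] by (auto simp: g_def split: prod.split)
          then have "(\<Sum>v\<in>A x. pmf (DM x) v * g v) \<le> (\<Sum>v\<in>A x. pmf (DM x) v * (starts A * p ^ j))"
            by (intro sum_mono mult_left_mono) auto
          also have "\<dots> = S * (starts A * p ^ j)" by (simp add: S_def sum_distrib_right)
          also have "\<dots> \<le> S * (starts A * p ^ j + height b Q)"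
            using S0 height_nonneg[of b Q] by (intro mult_left_mono) auto
          finally show ?thesis .
        qed
        finally show ?thesis using S0 by (simp add: S[symmetric] divide_right_mono)
      qed
    qed
  qed
qed

end


subsection \<open>Levels of popularity\<close>

text \<open>Levels are measured from the mass of \<open>Z\<close>, all the acceptable men but the most popular \<open>n - 1\<close>:
  this keeps the union bounds independent of the number of men, as the men of positive level
  number at most \<open>n - 1\<close> and a woman who prefers somebody in \<open>Z\<close> to a man of high level is
  unlikely even if \<open>Z\<close> is large.\<close>
locale popularity_market =
  fixes DM :: "'m::finite \<Rightarrow> 'w::finite pmf" and DW :: "'w \<Rightarrow> 'm pmf" and w0 :: 'w
    and Y Z :: "'m set" and Q R :: real
  assumes full: "\<And>m. set_pmf (DM m) = UNIV"
    and DW: "\<And>v. set_pmf (DW v) = Y"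
    and R: "R \<ge> 1" "\<And>m u v. pmf (DM m) u \<le> R * pmf (DM m) v"
    and Q: "Q \<ge> 1" "\<And>u v x y. x \<in> Y \<Longrightarrow> y \<in> Y \<Longrightarrow>
        pmf (DW v) x * pmf (DW u) y \<le> Q * (pmf (DW u) x * pmf (DW v) y)"
    and N2: "2 \<le> min CARD('m) CARD('w)"
    and Z: "Z \<subseteq> Y" "card Z = card Y - min (card Y) CARD('w) + 1"
      "\<And>A. A \<subseteq> Y \<Longrightarrow> card A = card Z \<Longrightarrow> sum (pmf (DW w0)) Z \<le> sum (pmf (DW w0)) A"
begin

definition "N = real (min CARD('m) CARD('w))"
definition "n = min (card Y) CARD('w)"
definition "D = pmf (DW w0)"
definition "T = sum D Z"
definition "B = N ^ 5 * Q"
text \<open>Truncation by \<open>nat\<close> puts everybody with \<open>D m < B * T\<close> on level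
  0, so levels say nothing about how far a man lies below \<open>T\<close>.\<close>

definition "lev m = nat \<lfloor>log B (D m / T)\<rfloor>"
definition "fair l \<longleftrightarrow> (\<forall>x\<in>Y. \<forall>y\<in>Y. lev y + 2 \<le> lev x \<longrightarrow> ranked_before l x y)"

lemma N_ge: "2 \<le> N"
  using N2 by (simp add: N_def)

lemma B_gt: "1 < B" "N ^ 5 \<le> B" "0 < B"
proof -
  have "1 < N ^ 5" using N_ge by (simp add: one_less_power)
  moreover show "N ^ 5 \<le> B"
    using Q(1) N_ge mult_left_mono[of 1 Q "N ^ 5"] by (simp add: B_def)
  ultimately show "1 < B" by linarith
  then show "0 < B" by linarith
qed

lemma Y_ne: "Y \<noteq> {}"
  using set_pmf_not_empty[of "DW w0"] by (simp add: DW)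

lemma n_ge: "1 \<le> n" "n \<le> card Y" "n \<le> CARD('w)" "real n \<le> N"
proof -
  show "1 \<le> n" "n \<le> card Y" "n \<le> CARD('w)"
    using Y_ne by (auto simp: n_def Suc_le_eq card_gt_0_iff)
  have "card Y \<le> CARD('m)" by (rule card_mono) auto
  then show "real n \<le> N" by (simp add: n_def N_def)
qed

lemma pmf_pos: "x \<in> Y \<Longrightarrow> 0 < pmf (DW v) x"
  using pmf_positive[of x "DW v"] by (simp add: DW)

lemma D_pos: "x \<in> Y \<Longrightarrow> 0 < D x"
  by (simp add: D_def pmf_pos)

lemma T_pos: "0 < T"
proof -
  have "Z \<noteq> {}" using Z(2) by auto
  then show ?thesis unfolding T_def using Z(1) D_pos by (intro sum_pos) auto
qed

text \<open>What remains has at least as many members as \<open>Z\<close>, whose mass is least among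
  the sets of its size.\<close>

lemma T_le:
  assumes "A \<subseteq> Y" "card (Y - A) < n"
  shows "T \<le> sum D A"
proof -
  have "card Y - card A < n" using assms card_Diff_subset[of A Y] by (simp add: finite_subset)
  then have "card Z \<le> card A" using n_ge(2) by (simp add: Z(2) n_def[symmetric])
  then obtain A' where A': "A' \<subseteq> A" "card A' = card Z" by (rule obtain_subset_with_card_n)
  have "T \<le> sum D A'" unfolding T_def D_def using A' assms by (intro Z(3)) auto
  also have "\<dots> \<le> sum D A" using A' by (intro sum_mono2) (auto simp: D_def)
  finally show ?thesis .
qed

lemma lev_Z: "x \<in> Z \<Longrightarrow> lev x = 0"
proof -
  assume x: "x \<in> Z"
  have "D x \<le> T" unfolding T_def by (rule member_le_sum) (use x in \<open>auto simp: D_def\<close>)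
  then have "log B (D x / T) \<le> 0"
    using T_pos B_gt D_pos[of x] x Z(1) by (subst log_le_zero_cancel_iff) auto
  then show ?thesis by (simp add: lev_def)
qed

lemma card_lev_pos: "card {x \<in> Y. 1 \<le> lev x} \<le> n - 1" "card (Y - Z) = n - 1"
proof -
  show eq: "card (Y - Z) = n - 1"
    using Z(1,2) n_ge by (simp add: card_Diff_subset finite_subset n_def[symmetric])
  have "card {x \<in> Y. 1 \<le> lev x} \<le> card (Y - Z)"
    by (rule card_mono) (auto dest: lev_Z)
  then show "card {x \<in> Y. 1 \<le> lev x} \<le> n - 1" by (simp add: eq)
qed

text \<open>Rounding loses less than one level, hence the gap of two in \<open>fair\<close>. The
  second bound serves to compare \<open>x\<close> with all of \<open>Z\<close> at once.\<close>

lemma lev_gap: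
  assumes "x \<in> Y" "y \<in> Y" "lev y + 2 \<le> lev x"
  shows "B * D y \<le> D x" "B * T \<le> D x"
proof -
  have tx: "real (lev x) \<le> log B (D x / T)"
    using assms(3) unfolding lev_def by linarith
  have ty: "log B (D y / T) \<le> real (lev y) + 1"
    unfolding lev_def by linarith
  have "log B (B * (D y / T)) = 1 + log B (D y / T)"
    using B_gt D_pos[OF assms(2)] T_pos by (subst log_mult) auto
  then have "log B (B * (D y / T)) \<le> log B (D x / T)"
    using tx ty assms(3) by linarith
  then have "B * (D y / T) \<le> D x / T"
    using B_gt D_pos[OF assms(1)] D_pos[OF assms(2)] T_pos by (subst (asm) log_le_cancel_iff) auto
  then show "B * D y \<le> D x" using T_pos by (simp add: field_simps)
  have "log B B \<le> log B (D x / T)" using tx assms(3) B_gt by simp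
  then have "B \<le> D x / T"
    using B_gt D_pos[OF assms(1)] T_pos by (subst (asm) log_le_cancel_iff) auto
  then show "B * T \<le> D x" using T_pos by (simp add: field_simps)
qed

lemma prob_prefers_le:
  assumes "x \<in> Y" "y \<in> Y" "x \<noteq> y"
  shows "measure_pmf.prob (popularity_list (DW v)) {l. ranked_before l y x} \<le> Q * (D y / D x)"
proof -
  have "measure_pmf.prob (popularity_list (DW v)) {l. ranked_before l y x} \<le> pmf (DW v) y / (pmf (DW v) x + pmf (DW v) y)"
    unfolding popularity_list_def by (rule prob_ranked_before_le) (use assms pmf_pos in auto)
  also have "\<dots> \<le> pmf (DW v) y / pmf (DW v) x"
    using pmf_pos[of x v] assms by (intro divide_left_mono mult_pos_pos add_pos_nonneg) auto
  also have "\<dots> \<le> Q * (D y / D x)"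
    using Q(2)[of y x v w0] assms pmf_pos[of x v] D_pos[of x] by (simp add: D_def field_simps)
  finally show ?thesis .
qed

text \<open>At most \<open>n - 1\<close> men have level 2 or more. Each has at most
  \<open>n - 2\<close> rivals outside \<open>Z\<close>, costing \<open>1 / N ^ 5\<close> each, while
  those in \<open>Z\<close> have total mass at most \<open>T\<close> and together cost another
  \<open>1 / N ^ 5\<close>, however many they are.\<close>

lemma prob_not_fair_le:
  "measure_pmf.prob (popularity_list (DW v)) {l. \<not> fair l} \<le> real (n - 1) * real (n - 1) / N ^ 5"
proof -
  define X where "X = {x \<in> Y. 2 \<le> lev x}"
  define L where "L x = {y \<in> Y. lev y + 2 \<le> lev x}" for x
  have XZ: "X \<subseteq> Y - Z" using lev_Z by (auto simp: X_def)
  have N5: "0 < N ^ 5" using N_ge by simp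
  have "measure_pmf.prob (popularity_list (DW v)) {l. \<not> fair l}
      \<le> measure_pmf.prob (popularity_list (DW v)) (\<Union>x\<in>X. \<Union>y\<in>L x. {l. ranked_before l y x})"
  proof (rule prob_mono_pmf)
    fix l assume l: "l \<in> set_pmf (popularity_list (DW v))" and nf: "l \<in> {l. \<not> fair l}"
    then obtain x y where xy: "x \<in> Y" "y \<in> Y" "lev y + 2 \<le> lev x" "\<not> ranked_before l x y"
      by (auto simp: fair_def)
    have "set l = Y" using draw_list_support[of l "DW v" UNIV] l by (simp add: popularity_list_def DW)
    moreover have "x \<noteq> y" using xy(3) by auto
    ultimately have "ranked_before l y x" using ranked_before_total[of x l y] xy by auto
    then show "l \<in> (\<Union>x\<in>X. \<Union>y\<in>L x. {l. ranked_before l y x})"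
      using xy by (auto simp: X_def L_def intro!: bexI[of _ x] bexI[of _ y])
  qed
  also have "\<dots> \<le> (\<Sum>x\<in>X. real (n - 1) / N ^ 5)"
  proof (rule prob_UN_le)
    fix x assume x: "x \<in> X"
    then have xY: "x \<in> Y" "x \<in> Y - Z" using XZ by (auto simp: X_def)
    have Dx: "0 < D x" by (rule D_pos[OF xY(1)])
    have "measure_pmf.prob (popularity_list (DW v)) (\<Union>y\<in>L x. {l. ranked_before l y x}) \<le> (\<Sum>y\<in>L x. Q * (D y / D x))"
    proof (rule prob_UN_le)
      fix y assume "y \<in> L x"
      then show "measure_pmf.prob (popularity_list (DW v)) {l. ranked_before l y x} \<le> Q * (D y / D x)"
        by (intro prob_prefers_le xY) (auto simp: L_def)
    qed simp
    also have "\<dots> = (\<Sum>y\<in>L x - Z. Q * (D y / D x)) + (\<Sum>y\<in>L x \<inter> Z. Q * (D y / D x))"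
      by (subst sum.Int_Diff[of _ _ Z]) auto
    also have "(\<Sum>y\<in>L x - Z. Q * (D y / D x)) \<le> (\<Sum>y\<in>L x - Z. 1 / N ^ 5)"
    proof (rule sum_mono)
      fix y assume "y \<in> L x - Z"
      then have "N ^ 5 * (Q * D y) \<le> D x" using lev_gap(1)[of x y] xY by (simp add: L_def B_def)
      then show "Q * (D y / D x) \<le> 1 / N ^ 5" using Dx N5 by (simp add: field_simps)
    qed
    also have "\<dots> \<le> real (n - 2) / N ^ 5"
    proof -
      have "card (L x - Z) \<le> card ((Y - Z) - {x})" by (rule card_mono) (auto simp: L_def)
      also have "\<dots> = n - 2" using xY card_lev_pos(2) by simp
      finally have "real (card (L x - Z)) / N ^ 5 \<le> real (n - 2) / N ^ 5"
        using N5 by (intro divide_right_mono) auto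
      then show ?thesis by simp
    qed
    also have "(\<Sum>y\<in>L x \<inter> Z. Q * (D y / D x)) \<le> (\<Sum>y\<in>Z. Q * (D y / D x))"
      using Dx Q(1) by (intro sum_mono2) (auto simp: D_def)
    also have "\<dots> = Q * (T / D x)" by (simp add: T_def sum_distrib_left sum_divide_distrib)
    also have "\<dots> \<le> 1 / N ^ 5"
    proof -
      have "Z \<noteq> {}" using Z(2) by auto
      then obtain z where z: "z \<in> Z" by blast
      then have "N ^ 5 * (Q * T) \<le> D x"
        using lev_gap(2)[of x z] lev_Z[OF z] x Z(1) by (auto simp: X_def B_def mult.assoc)
      then show ?thesis using Dx N5 by (simp add: field_simps)
    qed
    also have "real (n - 2) / N ^ 5 + 1 / N ^ 5 \<le> real (n - 1) / N ^ 5"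
    proof -
      have "n - 1 \<noteq> 0" using xY card_lev_pos(2) by (metis card_eq_0_iff empty_iff finite)
      then have "real (n - 2) + 1 = real (n - 1)" by simp
      then show ?thesis by (simp add: add_divide_distrib[symmetric])
    qed
    finally show "measure_pmf.prob (popularity_list (DW v)) (\<Union>y\<in>L x. {l. ranked_before l y x}) \<le> real (n - 1) / N ^ 5"
      by simp
  qed simp
  also have "\<dots> = real (card X) * (real (n - 1) / N ^ 5)" by simp
  also have "\<dots> \<le> real (n - 1) * (real (n - 1) / N ^ 5)"
  proof -
    have "card X \<le> card (Y - Z)" by (rule card_mono) (use XZ in auto)
    then show ?thesis using card_lev_pos(2) N5 by (intro mult_right_mono) auto
  qed
  finally show ?thesis by simp
qed

lemma set_popularity_list:
  "l \<in> set_pmf (popularity_list (DM m)) \<Longrightarrow> distinct l \<and> set l = UNIV"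
  "l' \<in> set_pmf (popularity_list (DW v)) \<Longrightarrow> distinct l' \<and> set l' = Y"
  using draw_list_support by (auto simp: popularity_list_def full DW)

abbreviation "PMs \<equiv> Pi_pmf UNIV [] (\<lambda>m. popularity_list (DM m))"
abbreviation "PWs \<equiv> Pi_pmf UNIV [] (\<lambda>v. popularity_list (DW v))"

lemma PM_ok: "PM \<in> set_pmf PMs \<Longrightarrow> distinct (PM m) \<and> set (PM m) = UNIV"
  by (rule set_popularity_list(1)) (auto simp: set_Pi_pmf PiE_dflt_def)

lemma PW_ok: "PW \<in> set_pmf PWs \<Longrightarrow> distinct (PW v) \<and> set (PW v) = Y"
  by (rule set_popularity_list(2)) (auto simp: set_Pi_pmf PiE_dflt_def)

text \<open>The order in which the men get their first turn.\<close>
definition "queue = rev (sort_key lev (SOME l. distinct l \<and> set l = Y))"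

lemma queue: "distinct queue" "set queue = Y" "sorted_wrt (\<lambda>x y. lev y \<le> lev x) queue"
proof -
  have "\<exists>l. distinct l \<and> set l = Y" using finite_distinct_list[of Y] by auto
  from someI_ex[OF this] show "distinct queue" "set queue = Y" by (simp_all add: queue_def)
  show "sorted_wrt (\<lambda>x y. lev y \<le> lev x) queue"
    unfolding queue_def sorted_wrt_rev
    using sorted_sort_key[of lev] by (simp add: sorted_wrt_map)
qed

abbreviation "run PM PW \<equiv> fst (da w0 PW (hd queue) queue PM Map.empty)"

text \<open>The woman \<open>w0\<close> always counts, since her own list decides between the two
  husbands and has to be fair too.\<close>

definition hit :: "('m \<Rightarrow> 'w list) \<Rightarrow> ('w \<Rightarrow> 'm list) \<Rightarrow> 'w \<Rightarrow> bool" where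
  "hit PM PW v \<longleftrightarrow> v = w0 \<or> (\<exists>b m. (b, m, v) \<in> set (run PM PW))"

lemma hit_upd: "hit PM (PW(v := l)) v \<longleftrightarrow> hit PM PW v"
  unfolding hit_def using hit_cong[of v "PW(v := l)" PW Map.empty w0 "hd queue" queue PM] by simp

lemma card_hit:
  assumes "PM \<in> set_pmf PMs" "PW \<in> set_pmf PWs"
  shows "card {v. hit PM PW v} \<le> n + 1"
proof -
  obtain tr L f where da: "da w0 PW (hd queue) queue PM Map.empty = (tr, L, f)" by (metis prod_cases3)
  have inv0: "da_inv w0 PW Y queue (\<lambda>m. set (PM m)) Map.empty"
    using PM_ok[OF assms(1)] da_inv_init[of queue Y w0 PW] queue by simp
  have fin: "da_inv w0 PW Y [] (\<lambda>m. set (L m)) f" "{v. \<exists>b m. (b, m, v) \<in> set tr} \<subseteq> insert w0 (dom f)"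
    using da_final(1,5)[OF da _ _ _ inv0] PM_ok[OF assms(1)] PW_ok[OF assms(2)] queue by auto
  have "card (dom f) = card ((\<lambda>v. the (f v)) ` dom f)"
    by (rule card_image[symmetric]) (use fin(1) in \<open>fastforce simp: inj_on_def da_inv_def\<close>)
  also have "\<dots> \<le> card Y"
    by (rule card_mono) (use fin(1) in \<open>auto simp: da_inv_def ran_def\<close>)
  finally have "card (dom f) \<le> card Y" .
  moreover have "{v. hit PM PW v} \<subseteq> insert w0 (dom f)" using fin(2) da by (auto simp: hit_def)
  then have "card {v. hit PM PW v} \<le> card (insert w0 (dom f))" by (rule card_mono[rotated]) simp
  moreover have "card (insert w0 (dom f)) \<le> Suc (card (dom f))" by (rule card_insert_le_m1) simp_all
  moreover have "card {v. hit PM PW v} \<le> CARD('w)" by (rule card_mono) auto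
  ultimately show ?thesis by (simp add: n_def)
qed

text \<open>By \<open>hit_upd\<close> being hit is independent of having an unfair list, and the
  expected number of hit women is at most \<open>n + 1\<close>; so the union over all women costs
  this factor instead of their number.\<close>

lemma prob_hit_unfair_le:
  "measure_pmf.prob (pair_pmf PMs PWs) {(PM, PW). \<exists>v. hit PM PW v \<and> \<not> fair (PW v)}
    \<le> real (n + 1) * (real (n - 1) * real (n - 1) / N ^ 5)"
proof -
  define \<beta> where "\<beta> = real (n - 1) * real (n - 1) / N ^ 5"
  have \<beta>: "\<beta> \<ge> 0" using N_ge by (simp add: \<beta>_def)
  have v: "measure_pmf.prob (pair_pmf PMs PWs) {(PM, PW). hit PM PW v \<and> \<not> fair (PW v)}
      \<le> measure_pmf.prob (pair_pmf PMs PWs) {(PM, PW). hit PM PW v} * \<beta>" for v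
  proof -
    have "measure_pmf.prob (pair_pmf PMs PWs) {(PM, PW). hit PM PW v \<and> \<not> fair (PW v)}
        = measure_pmf.prob (pair_pmf PMs PWs) {(PM, PW). hit PM PW v}
          * measure_pmf.prob (popularity_list (DW v)) {l. \<not> fair l}"
      unfolding prob_pair_pmf
      by (subst prob_Pi_pmf_component[where P = "\<lambda>l. \<not> fair l"]) (simp_all add: hit_upd)
    also have "\<dots> \<le> measure_pmf.prob (pair_pmf PMs PWs) {(PM, PW). hit PM PW v} * \<beta>"
      unfolding \<beta>_def by (intro mult_left_mono prob_not_fair_le) simp
    finally show ?thesis .
  qed
  have "measure_pmf.prob (pair_pmf PMs PWs) {(PM, PW). \<exists>v. hit PM PW v \<and> \<not> fair (PW v)}
     = measure_pmf.prob (pair_pmf PMs PWs) (\<Union>v\<in>UNIV. {(PM, PW). hit PM PW v \<and> \<not> fair (PW v)})"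
    by (rule arg_cong[of _ _ "measure_pmf.prob _"]) auto
  also have "\<dots> \<le> (\<Sum>v\<in>UNIV. measure_pmf.prob (pair_pmf PMs PWs) {(PM, PW). hit PM PW v} * \<beta>)"
    by (rule prob_UN_le) (use v in auto)
  also have "\<dots> = (\<Sum>v\<in>UNIV. measure_pmf.prob (pair_pmf PMs PWs) {P. hit (fst P) (snd P) v}) * \<beta>"
    by (simp only: sum_distrib_right case_prod_beta')
  also have "\<dots> \<le> real (n + 1) * \<beta>"
    using \<beta> card_hit by (intro mult_right_mono sum_prob_le) auto
  finally show ?thesis by (simp add: \<beta>_def)
qed

text \<open>A stable husband of two women is among the first \<open>n\<close> men on both their lists, which is
  unlikely for a man of very small popularity.\<close>
definition shared_unpopular :: "('w \<Rightarrow> 'm list) \<Rightarrow> bool" where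
  "shared_unpopular PW \<longleftrightarrow>
    (\<exists>v x. v \<noteq> w0 \<and> x \<in> Y \<and> D x < T / B\<^sup>2 \<and> x \<in> set (take n (PW w0)) \<and> x \<in> set (take n (PW v)))"

lemma prob_take_unpopular_le:
  assumes x: "x \<in> Y" "D x < T / B\<^sup>2"
  shows "measure_pmf.prob (popularity_list (DW v)) {l. x \<in> set (take n l)} \<le> n * Q / B\<^sup>2"
proof -
  \<comment> \<open>A lower bound for the mass that \<open>v\<close> has left after fewer than
    \<open>n\<close> draws: by \<open>Q(2)\<close> each remaining \<open>y\<close> weighs at least
    \<open>pmf (DW v) x / (Q * D x)\<close> times \<open>D y\<close>, and these \<open>D y\<close>
    sum to at least \<open>T\<close>.\<close>
  define \<tau> where "\<tau> = pmf (DW v) x * T / (Q * D x)"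
  have pos: "0 < pmf (DW v) x" "0 < D x" "0 < Q" using x D_pos pmf_pos Q(1) by auto
  then have \<tau>: "0 < \<tau>" using T_pos by (simp add: \<tau>_def)
  have "measure_pmf.prob (popularity_list (DW v)) {l. x \<in> set (take n l)} \<le> n * (pmf (DW v) x / \<tau>)"
    unfolding popularity_list_def
  proof (rule prob_take_le[OF \<tau>])
    fix A :: "'m set" assume A: "A \<subseteq> UNIV" "card (UNIV - A) < n"
    have "card (Y - A \<inter> Y) \<le> card (UNIV - A)" by (rule card_mono) auto
    then have T: "T \<le> sum D (A \<inter> Y)" using A by (intro T_le) auto
    have "\<tau> = pmf (DW v) x / (Q * D x) * T" by (simp add: \<tau>_def)
    also have "\<dots> \<le> pmf (DW v) x / (Q * D x) * sum D (A \<inter> Y)"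
      using T pos by (intro mult_left_mono) auto
    also have "\<dots> = (\<Sum>y\<in>A \<inter> Y. pmf (DW v) x / (Q * D x) * D y)" by (rule sum_distrib_left)
    also have "\<dots> \<le> (\<Sum>y\<in>A \<inter> Y. pmf (DW v) y)"
    proof (rule sum_mono)
      fix y assume "y \<in> A \<inter> Y"
      then show "pmf (DW v) x / (Q * D x) * D y \<le> pmf (DW v) y"
        using Q(2)[of x y v w0] x pos by (simp add: D_def field_simps)
    qed
    also have "\<dots> \<le> measure_pmf.prob (DW v) A"
      by (subst measure_measure_pmf_finite) (auto intro: sum_mono2)
    finally show "\<tau> \<le> measure_pmf.prob (DW v) A" .
  qed
  also have "pmf (DW v) x / \<tau> = Q * (D x / T)" using pos T_pos by (simp add: \<tau>_def)
  also have "D x / T \<le> 1 / B\<^sup>2" using x(2) T_pos B_gt by (simp add: field_simps)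
  finally show ?thesis using Q(1) by (simp add: mult_left_mono)
qed

text \<open>The small probability is used only for the list of \<open>v\<close>. For the independent
  list of \<open>w0\<close> it is enough that \<open>n\<close> men fill its first \<open>n\<close>
  places, so the number of unpopular men does not enter.\<close>

lemma prob_shared_unpopular_le:
  "measure_pmf.prob PWs {PW. shared_unpopular PW} \<le> CARD('w) * (n * (n * Q / B\<^sup>2))"
proof -
  define U where "U = {x \<in> Y. D x < T / B\<^sup>2}"
  define q where "q x = measure_pmf.prob (popularity_list (DW w0)) {l. x \<in> set (take n l)}" for x
  have c: "0 \<le> n * Q / B\<^sup>2" using Q(1) by simp
  have "measure_pmf.prob PWs {PW. shared_unpopular PW}
    \<le> measure_pmf.prob PWs (\<Union>v\<in>UNIV - {w0}. \<Union>x\<in>U. {PW. x \<in> set (take n (PW w0)) \<and> x \<in> set (take n (PW v))})"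
    by (rule prob_mono_pmf) (auto simp: shared_unpopular_def U_def)
  also have "\<dots> \<le> (\<Sum>v\<in>UNIV - {w0}. n * (n * Q / B\<^sup>2))"
  proof (rule prob_UN_le)
    fix v assume v: "v \<in> UNIV - {w0}"
    have "measure_pmf.prob PWs (\<Union>x\<in>U. {PW. x \<in> set (take n (PW w0)) \<and> x \<in> set (take n (PW v))})
      \<le> (\<Sum>x\<in>U. q x * (n * Q / B\<^sup>2))"
    proof (rule prob_UN_le)
      fix x assume x: "x \<in> U"
      have "map_pmf (\<lambda>f. f w0) PWs = popularity_list (DW w0)" by (simp add: Pi_pmf_component)
      then have "q x = measure_pmf.prob (map_pmf (\<lambda>f. f w0) PWs) {l. x \<in> set (take n l)}"
        by (simp only: q_def)
      then have q: "q x = measure_pmf.prob PWs {PW. x \<in> set (take n (PW w0))}"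
        by (simp add: vimage_def)
      have "measure_pmf.prob PWs {PW. x \<in> set (take n (PW w0)) \<and> x \<in> set (take n (PW v))} =
          q x * measure_pmf.prob (popularity_list (DW v)) {l. x \<in> set (take n l)}"
        unfolding q by (rule prob_Pi_pmf_component[where P = "\<lambda>l. x \<in> set (take n l)"]) (use v in auto)
      also have "\<dots> \<le> q x * (n * Q / B\<^sup>2)"
        using x by (intro mult_left_mono prob_take_unpopular_le) (auto simp: U_def q_def)
      finally show "measure_pmf.prob PWs {PW. x \<in> set (take n (PW w0)) \<and> x \<in> set (take n (PW v))} \<le> q x * (n * Q / B\<^sup>2)" .
    qed simp
    also have "\<dots> = (\<Sum>x\<in>U. q x) * (n * Q / B\<^sup>2)" by (rule sum_distrib_right[symmetric])
    also have "\<dots> \<le> n * (n * Q / B\<^sup>2)"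
    proof (rule mult_right_mono[OF _ c])
      have "(\<Sum>x\<in>U. q x) \<le> (\<Sum>x\<in>UNIV. q x)" by (rule sum_mono2) (auto simp: q_def)
      also have "\<dots> \<le> n" unfolding q_def
      proof (rule sum_prob_le)
        fix l :: "'m list"
        show "card {x. x \<in> set (take n l)} \<le> n" using card_length[of "take n l"] by simp
      qed
      finally show "(\<Sum>x\<in>U. q x) \<le> n" .
    qed
    finally show "measure_pmf.prob PWs (\<Union>x\<in>U. {PW. x \<in> set (take n (PW w0)) \<and> x \<in> set (take n (PW v))}) \<le> n * (n * Q / B\<^sup>2)" .
  qed simp
  also have "\<dots> = card (UNIV - {w0}) * (n * (n * Q / B\<^sup>2))" by (rule sum_constant)
  also have "\<dots> \<le> CARD('w) * (n * (n * Q / B\<^sup>2))"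
    using mult_nonneg_nonneg[OF of_nat_0_le_iff[of n] c]
    by (intro mult_right_mono) (auto intro: card_mono)
  finally show ?thesis .
qed

text \<open>A single man whom \<open>v\<close> prefers to \<open>x\<close> would block, so
  \<open>x\<close> and all men above him on her list are matched, to different women.\<close>

lemma stable_husband_rank:
  fixes \<mu> :: "('m \<times> 'w) set"
  assumes ok: "\<And>m. distinct (PM m) \<and> set (PM m) = UNIV" "\<And>v. distinct (PW v) \<and> set (PW v) = Y"
    and st: "stable_matching PM PW \<mu>" and x: "(x, v) \<in> \<mu>" and n: "n = CARD('w)"
  shows "x \<in> set (take n (PW v))"
proof -
  have "x \<in> set (PW v)" by (rule stable_matchingD(4)[OF st x])
  then obtain i where i: "i < length (PW v)" "PW v ! i = x" by (auto simp: in_set_conv_nth)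
  have "set (take (Suc i) (PW v)) \<subseteq> Domain \<mu>"
  proof
    fix y assume "y \<in> set (take (Suc i) (PW v))"
    then obtain k where k: "k < Suc i" "PW v ! k = y" using i by (auto simp: in_set_conv_nth)
    show "y \<in> Domain \<mu>"
    proof (rule ccontr)
      assume y: "y \<notin> Domain \<mu>"
      then have "k < i" using k i x by (cases "k = i") auto
      then have "ranked_before (PW v) y x" using k i by (auto simp: ranked_before_def)
      show False
      proof (rule stable_no_block[OF st, of v y])
        show "y \<in> set (PW v)" using k i nth_mem[of k "PW v"] by auto
        show "ranked_before (PW v) y z" if "(z, v) \<in> \<mu>" for z
          using stable_matchingD(2)[OF st that x] \<open>ranked_before (PW v) y x\<close> by simp
      qed (use ok y in auto)
    qed
  qed
  then have "card (set (take (Suc i) (PW v))) \<le> card (Domain \<mu>)" by (rule card_mono[rotated]) simp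
  also have "card (Domain \<mu>) \<le> CARD('w)"
  proof -
    have "Domain \<mu> \<subseteq> (\<lambda>u. THE m. (m, u) \<in> \<mu>) ` UNIV"
    proof
      fix m assume "m \<in> Domain \<mu>"
      then obtain u where u: "(m, u) \<in> \<mu>" by blast
      then have "(THE m. (m, u) \<in> \<mu>) = m"
        using stable_matchingD(2)[OF st] by (intro the_equality) blast+
      then show "m \<in> (\<lambda>u. THE m. (m, u) \<in> \<mu>) ` UNIV" by (metis rangeI)
    qed
    then have "card (Domain \<mu>) \<le> card (range (\<lambda>u. THE m. (m, u) \<in> \<mu>))" by (rule card_mono[rotated]) simp
    then show ?thesis using card_image_le[of "UNIV :: 'w set" "\<lambda>u. THE m. (m, u) \<in> \<mu>"] by simp
  qed
  also have "card (set (take (Suc i) (PW v))) = Suc i"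
    using ok(2)[of v] i by (simp add: distinct_card)
  finally have "i < n" using n by simp
  then show ?thesis using i by (auto simp: in_set_conv_nth)
qed

text \<open>If \<open>card Y \<le> CARD('w)\<close>, then \<open>Z\<close> is a single least popular
  man and \<open>T\<close> a lower bound for everybody in \<open>Y\<close>. Otherwise
  \<open>x\<close> is matched in \<open>\<nu>\<close> as well, to a woman other than
  \<open>w0\<close>, and so is among the first \<open>n\<close> men on two lists.\<close>

lemma stable_husband_popular:
  assumes ok: "\<And>m. distinct (PM m) \<and> set (PM m) = UNIV" "\<And>v. distinct (PW v) \<and> set (PW v) = Y"
    and shared: "CARD('w) < card Y \<Longrightarrow> \<not> shared_unpopular PW"
    and st: "stable_matching PM PW \<mu>" "stable_matching PM PW \<nu>"
    and x: "(x, w0) \<in> \<mu>" "(y, w0) \<in> \<nu>" "x \<noteq> y"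
  shows "T / B\<^sup>2 \<le> D x"
proof -
  have xY: "x \<in> Y" using stable_matchingD(4)[OF st(1) x(1)] ok by auto
  show ?thesis
  proof (cases "CARD('w) < card Y")
    case False
    then have "T \<le> D x" using T_le[of "{x}"] xY n_ge(1) by (simp add: n_def card_Diff_singleton)
    moreover have "T / B\<^sup>2 \<le> T" using B_gt T_pos by (simp add: field_simps)
    ultimately show ?thesis by linarith
  next
    case True
    then have n: "n = CARD('w)" by (simp add: n_def)
    have "x \<in> Domain \<nu>" by (rule stable_men_same[OF st(2,1) _ _ x(1)]) (use ok in auto)
    then obtain v where v: "(x, v) \<in> \<nu>" by blast
    have "v \<noteq> w0" using stable_matchingD(2)[OF st(2) x(2)] v x(3) by blast
    moreover have "x \<in> set (take n (PW w0))" "x \<in> set (take n (PW v))"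
      using stable_husband_rank[OF ok st(1) x(1) n] stable_husband_rank[OF ok st(2) v n] by auto
    ultimately show ?thesis using shared[OF True] xY by (force simp: shared_unpopular_def not_less)
  qed
qed

end


section \<open>Cells, climbs and the resulting probability bound\<close>

context popularity_market
begin

text \<open>\<open>J\<close> solves \<open>(1 + 1 / R) powr J = N ^ 4\<close>: over this many levels
  the success probability of a climb falls to \<open>1 / N ^ 4\<close>.\<close>

definition "J = 4 * ln N / ln (1 + 1 / R)"
definition "K = 4 * ln N * (1 + log 2 N) / ln (1 + 1 / R)"
definition "j = nat \<lceil>J\<rceil>"

definition "cell a \<longleftrightarrow>
  card {y \<in> Y. a \<le> lev y \<and> lev y \<le> a + j + 1} + card {y \<in> Y. a \<le> lev y} \<le> CARD('w) + 1"

text \<open>Otherwise \<open>n + 2\<close> minus the number of men above \<open>a\<close> would double from each of \<open>s\<close> consecutive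
  intervals to the next.\<close>
lemma exists_cell:
  assumes "2 \<le> n" "n < 2 * 2 ^ s" "1 \<le> l"
  shows "\<exists>k<s. cell (l + k * (j + 2))"
proof (rule ccontr)
  assume no: "\<not> ?thesis"
  define H where "H a = card {y \<in> Y. a \<le> lev y}" for a
  have step: "H (a + (j + 2)) + n + 2 \<le> 2 * H a" if "\<not> cell a" for a
  proof -
    have "{y \<in> Y. a \<le> lev y \<and> lev y \<le> a + j + 1} = {y \<in> Y. a \<le> lev y} - {y \<in> Y. a + (j + 2) \<le> lev y}"
      by auto
    moreover have sub: "{y \<in> Y. a + (j + 2) \<le> lev y} \<subseteq> {y \<in> Y. a \<le> lev y}" by auto
    ultimately have "card {y \<in> Y. a \<le> lev y \<and> lev y \<le> a + j + 1} = H a - H (a + (j + 2))"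
      by (simp add: H_def card_Diff_subset)
    moreover have "H (a + (j + 2)) \<le> H a" unfolding H_def by (rule card_mono[OF _ sub]) simp
    moreover have "CARD('w) + 1 < card {y \<in> Y. a \<le> lev y \<and> lev y \<le> a + j + 1} + H a"
      using that by (simp add: cell_def H_def)
    ultimately show ?thesis using n_ge(3) by linarith
  qed
  \<comment> \<open>For \<open>n + 2 - H\<close> the inequality \<open>step\<close> says that the
    value at least doubles; it starts at 3 or more since at most \<open>n - 1\<close> men have
    positive level.\<close>
  have "3 * 2 ^ k + H (l + k * (j + 2)) \<le> n + 2" if "k \<le> s" for k
    using that
  proof (induction k)
    case 0
    have "H l \<le> card {x \<in> Y. 1 \<le> lev x}" unfolding H_def by (rule card_mono) (use assms in auto)
    then show ?case using card_lev_pos(1) assms(1) by simp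
  next
    case (Suc k)
    have "\<not> cell (l + k * (j + 2))" using no Suc by auto
    from step[OF this] Suc show ?case by (simp add: algebra_simps)
  qed
  from this[of s] assms show False by simp
qed

lemma R_pos: "0 < ln (1 + 1 / R)" "ln (1 + 1 / R) \<le> ln 2"
proof -
  show "0 < ln (1 + 1 / R)" using R(1) by (intro ln_gt_zero) simp
  have "1 + 1 / R \<le> 2" "0 < 1 + 1 / R" using R(1) by (auto simp: field_simps)
  then show "ln (1 + 1 / R) \<le> ln 2" by simp
qed

lemma J_ge: "4 * log 2 N \<le> J" "0 < J"
proof -
  have "4 * ln N / ln 2 \<le> 4 * ln N / ln (1 + 1 / R)"
    using R_pos N_ge by (intro divide_left_mono) auto
  then show "4 * log 2 N \<le> J" by (simp add: J_def log_def)
  show "0 < J" using R_pos N_ge by (simp add: J_def)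
qed

lemma K_eq: "K = J * (1 + log 2 N)"
  by (simp add: K_def J_def)

text \<open>The extra summand \<open>J\<close> in \<open>K\<close> absorbs all rounding:
  \<open>3 * s + 1 \<le> 4 * s \<le> 4 * log 2 N \<le> J\<close>, where the last step rests on
  \<open>R \<ge> 1\<close>.\<close>

lemma K_ge:
  assumes "1 \<le> s" "real s \<le> log 2 N"
  shows "real (s * (j + 2)) + 1 \<le> K"
proof -
  have "real j \<le> J + 1" using J_ge unfolding j_def by linarith
  then have "real (s * (j + 2)) \<le> real s * (J + 3)"
    unfolding of_nat_mult by (intro mult_left_mono) auto
  moreover have "J * real s \<le> J * log 2 N" using assms J_ge by (intro mult_left_mono) auto
  moreover have "K = J + J * log 2 N" "real s * (J + 3) = J * real s + 3 * real s"
    by (simp_all add: K_eq algebra_simps)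
  moreover have "1 \<le> real s" using assms(1) by simp
  ultimately show ?thesis using assms(2) J_ge(1) by linarith
qed

lemma power_j_le: "(R / (1 + R)) ^ j \<le> 1 / N ^ 4"
proof -
  have "4 * ln N = J * ln (1 + 1 / R)" using R_pos by (simp add: J_def)
  also have "\<dots> \<le> real j * ln (1 + 1 / R)"
    using R_pos J_ge unfolding j_def by (intro mult_right_mono) auto
  finally have "ln (N ^ 4) \<le> ln ((1 + 1 / R) ^ j)"
    using N_ge R(1) by (simp add: ln_realpow)
  then have le: "N ^ 4 \<le> (1 + 1 / R) ^ j"
    using N_ge R(1) by (subst (asm) ln_le_cancel_iff) (auto intro!: zero_less_power add_pos_pos)
  have "R / (1 + R) = 1 / (1 + 1 / R)" using R(1) by (simp add: field_simps)
  then have "(R / (1 + R)) ^ j = 1 / (1 + 1 / R) ^ j" by (simp add: power_one_over)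
  also have "\<dots> \<le> 1 / N ^ 4" using le N_ge by (intro divide_left_mono) (auto intro!: mult_pos_pos order_less_le_trans[OF _ le])
  finally show ?thesis .
qed

definition climb :: "('m \<Rightarrow> 'w list) \<Rightarrow> ('w \<Rightarrow> 'm list) \<Rightarrow> bool" where
  "climb PM PW \<longleftrightarrow> (\<forall>v. hit PM PW v \<longrightarrow> fair (PW v)) \<and>
     (\<exists>a\<ge>1. cell a \<and> (\<exists>(b, x, v) \<in> set (run PM PW). lev b \<le> a \<and> a + j + 1 \<le> lev x))"

text \<open>The union over the starting levels \<open>a\<close> costs nothing extra: at level
  \<open>a\<close> the number of starts is \<open>n - 1\<close> times the number of men there, and
  the men of positive level sum to at most \<open>n - 1\<close>.\<close>

lemma prob_climb_le:
  assumes PW: "PW \<in> set_pmf PWs"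
  shows "measure_pmf.prob PMs {PM. climb PM PW} \<le> (real (n - 1))\<^sup>2 / N ^ 4"
proof -
  define I where "I = {a. 1 \<le> a \<and> a \<le> Max (range lev) \<and> cell a}"
  define c where "c a = card {m \<in> Y. lev m = a}" for a
  define E where "E a = {PM. (\<forall>v. hit PM PW v \<longrightarrow> fair (PW v)) \<and>
     (\<exists>(b, x, v) \<in> set (run PM PW). lev b \<le> a \<and> a + j + 1 \<le> lev x)}" for a
  have fI: "finite I" by (rule finite_subset[of _ "{..Max (range lev)}"]) (auto simp: I_def)
  have "{PM. climb PM PW} \<subseteq> (\<Union>a\<in>I. E a)"
  proof
    fix PM assume "PM \<in> {PM. climb PM PW}"
    then obtain a b x v where a: "\<forall>v. hit PM PW v \<longrightarrow> fair (PW v)" "1 \<le> a" "cell a"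
        "(b, x, v) \<in> set (run PM PW)" "lev b \<le> a" "a + j + 1 \<le> lev x"
      by (auto simp: climb_def)
    have "lev x \<le> Max (range lev)" by (rule Max_ge) auto
    then have "a \<le> Max (range lev)" using a(6) by linarith
    then have "a \<in> I" using a by (simp add: I_def)
    moreover have "PM \<in> E a" using a by (auto simp: E_def)
    ultimately show "PM \<in> (\<Union>a\<in>I. E a)" by blast
  qed
  then have "measure_pmf.prob PMs {PM. climb PM PW} \<le> measure_pmf.prob PMs (\<Union>a\<in>I. E a)"
    by (rule measure_pmf.finite_measure_mono) simp
  also have "\<dots> \<le> (\<Sum>a\<in>I. real (c a) * (real (n - 1) / N ^ 4))"
  proof (rule prob_UN_le[OF fI])
    fix a assume a: "a \<in> I"
    \<comment> \<open>The women's lists are fixed; only the men's are random.\<close>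
    interpret C: climbing DM PW w0 Y lev "{v. fair (PW v)}" R a j n
      by unfold_locales
        (use full PW_ok[OF PW] R a in \<open>auto simp: fair_def I_def cell_def n_def\<close>)
    have "measure_pmf.prob PMs (E a) \<le> measure_pmf.prob PMs {PM. C.climbs (run PM PW)}"
      by (rule measure_pmf.finite_measure_mono) (auto simp: E_def C.climbs_def hit_def)
    also have "\<dots> \<le> C.starts (\<lambda>_. UNIV) * C.p ^ j + C.height (hd queue) queue"
      unfolding popularity_list_def
      by (rule C.prob_climbs_le[OF da_inv_init]) (use queue in auto)
    also have "C.height (hd queue) queue = 0" by (rule C.height_turn)
    also have "C.starts (\<lambda>_. UNIV) = c a * (n - 1)" by (simp add: C.starts_def c_def)
    also have "real (c a * (n - 1)) * C.p ^ j + 0 \<le> real (c a * (n - 1)) * (1 / N ^ 4)"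
      unfolding C.p_def add_0_right by (intro mult_left_mono power_j_le) simp
    finally show "measure_pmf.prob PMs (E a) \<le> real (c a) * (real (n - 1) / N ^ 4)" by simp
  qed
  also have "\<dots> = real (\<Sum>a\<in>I. c a) * (real (n - 1) / N ^ 4)"
    unfolding of_nat_sum by (rule sum_distrib_right[symmetric])
  also have "\<dots> \<le> real (n - 1) * (real (n - 1) / N ^ 4)"
  proof -
    have "(\<Sum>a\<in>I. c a) = card (\<Union>a\<in>I. {m \<in> Y. lev m = a})"
      unfolding c_def by (rule card_UN_disjoint[symmetric]) (use fI in auto)
    also have "\<dots> \<le> card {m \<in> Y. 1 \<le> lev m}" by (rule card_mono) (auto simp: I_def)
    also have "\<dots> \<le> n - 1" by (rule card_lev_pos)
    finally have "real (\<Sum>a\<in>I. c a) \<le> real (n - 1)" by (rule of_nat_mono)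
    then show ?thesis using N_ge by (intro mult_right_mono) auto
  qed
  finally show ?thesis by (simp add: power2_eq_square)
qed

lemma climb_if_popularity_gap:
  assumes PM: "PM \<in> set_pmf PMs" and PW: "PW \<in> set_pmf PWs"
    and fair: "\<And>v. hit PM PW v \<Longrightarrow> fair (PW v)"
    and shared: "CARD('w) < card Y \<Longrightarrow> \<not> shared_unpopular PW"
    and h: "stable_husband PM PW w0 h" and l: "stable_husband PM PW w0 l"
    and gap: "B powr (1 + K) < D h / D l"
  shows "climb PM PW"
proof -
  obtain \<mu> where \<mu>: "stable_matching PM PW \<mu>" "(h, w0) \<in> \<mu>" using h by (auto simp: stable_husband_def)
  obtain \<nu> where \<nu>: "stable_matching PM PW \<nu>" "(l, w0) \<in> \<nu>" using l by (auto simp: stable_husband_def)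
  note okM = PM_ok[OF PM] and okW = PW_ok[OF PW]
  have Y: "h \<in> Y" "l \<in> Y"
    using stable_matchingD(4)[OF \<mu>] stable_matchingD(4)[OF \<nu>] okW by auto
  have Dpos: "0 < D h" "0 < D l" using Y D_pos by auto
  have "0 \<le> log 2 N" using N_ge by simp
  then have K0: "0 \<le> K" using J_ge by (simp add: K_eq)
  have "h \<noteq> l"
  proof
    assume "h = l"
    then have "B powr (1 + K) < 1" using gap Dpos by simp
    moreover have "1 \<le> B powr (1 + K)" using B_gt K0 by (intro ge_one_powr_ge_zero) auto
    ultimately show False by simp
  qed
  have n2: "2 \<le> n"
  proof -
    have "card {h, l} \<le> card Y" by (rule card_mono) (use Y in auto)
    then show ?thesis using \<open>h \<noteq> l\<close> N2 by (simp add: n_def)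
  qed
  have low: "T / B\<^sup>2 \<le> D l"
    by (rule stable_husband_popular[OF okM okW shared \<nu>(1) \<mu>(1) \<nu>(2) \<mu>(2)]) (use \<open>h \<noteq> l\<close> in auto)
  define s where "s = nat \<lfloor>log 2 n\<rfloor>"
  have s: "1 \<le> s" "real s \<le> log 2 N" "n < 2 * 2 ^ s"
  proof -
    have "1 \<le> log 2 (real n)" using n2 by (simp add: le_log_iff)
    then have ns: "1 \<le> s" "real s \<le> log 2 n" "log 2 n < real s + 1" unfolding s_def by linarith+
    show "1 \<le> s" by fact
    have "log 2 n \<le> log 2 N" using n2 n_ge(4) by simp
    then show "real s \<le> log 2 N" using ns by linarith
    have "real n < 2 powr (real s + 1)" using ns(3) n2 by (simp add: log_less_iff)
    also have "\<dots> = real (2 * 2 ^ s)" by (simp add: powr_add powr_realpow)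
    finally show "n < 2 * 2 ^ s" by (simp only: of_nat_less_iff)
  qed
  define L where "L = s * (j + 2)"
  have L: "real L + 1 \<le> K" unfolding L_def by (rule K_ge) (use s in auto)
  have j1: "1 \<le> j" using J_ge unfolding j_def by linarith
  have "1 * (j + 2) \<le> L" unfolding L_def by (intro mult_right_mono) (use s in auto)
  then have L3: "3 \<le> L" using j1 by simp
  \<comment> \<open>If \<open>tl < 0\<close>, the level of \<open>l\<close> hides part of the ratio,
    but by \<open>low\<close> at most two levels, and \<open>1 + K - 2\<close> is still at least
    \<open>L\<close>. Otherwise the 1 in the exponent is enough for rounding.\<close>
  have lev: "max 1 (lev l) + L \<le> lev h + 1"
  proof -
    define tl th where "tl = log B (D l / T)" and "th = log B (D h / T)"
    have "- 2 = log B (1 / B\<^sup>2)" using B_gt by (simp add: log_divide log_nat_power)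
    also have "\<dots> \<le> tl" unfolding tl_def
      using B_gt T_pos low Dpos by (subst log_le_cancel_iff) (auto simp: field_simps)
    finally have tl: "- 2 \<le> tl" .
    have "1 + K = log B (B powr (1 + K))" using B_gt by simp
    also have "\<dots> < log B (D h / D l)" using gap B_gt Dpos by (subst log_less_cancel_iff) auto
    also have "\<dots> = th - tl" using B_gt Dpos T_pos by (simp add: th_def tl_def log_divide)
    finally have th: "1 + K + tl < th" by simp
    have lh: "th < real (lev h) + 1" unfolding lev_def th_def by linarith
    show ?thesis
    proof (cases "tl < 0")
      case True
      then have "lev l = 0" unfolding lev_def tl_def by simp
      then show ?thesis using th lh tl L by simp
    next
      case False
      then have "real (lev l) \<le> tl" unfolding lev_def tl_def by linarith
      then have "real (lev l + L + 1) < real (lev h + 1)" using th lh L by simp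
      then show ?thesis by (simp only: of_nat_less_iff)
    qed
  qed
  have hl: "lev l + 2 \<le> lev h" using lev L3 by simp
  have "fair (PW w0)" by (rule fair) (simp add: hit_def)
  then have rb: "ranked_before (PW w0) h l" using hl Y by (simp add: fair_def)
  obtain b where b: "(b, h, w0) \<in> set (run PM PW)"
    using stable_husband_proposes[OF \<mu>, of Y queue "hd queue"] okM okW queue by blast
  \<comment> \<open>A head of maximal level cannot be \<open>l\<close>, so \<open>l\<close> waits in
    the tail, as \<open>origin_after\<close> requires.\<close>
  have lb: "lev b \<le> lev l"
  proof (rule origin_after[OF b \<nu>])
    show "da_inv w0 PW Y queue (\<lambda>m. set (PM m)) Map.empty"
      using okM da_inv_init[of queue Y w0 PW] queue by simp
    show "suffixes PM PM" by (auto simp: suffixes_def)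
    show "no_partner_lost \<nu> PM Map.empty" using okM by (simp add: no_partner_lost_def)
    obtain q Q1 where q: "queue = q # Q1" using queue(2) Y by (cases queue) auto
    then have "lev h \<le> lev q" using queue(2,3) Y by auto
    then have "l \<noteq> q" using hl by auto
    then show "l \<in> set (tl queue)" using q queue(2) Y by auto
    show "sorted_wrt (\<lambda>x y. lev y \<le> lev x) (tl queue)" using q queue(3) by auto
  qed (use okM okW rb in auto)
  \<comment> \<open>The search starts at level 1 or higher because level 0 may be crowded.\<close>
  obtain k where k: "k < s" "cell (max 1 (lev l) + k * (j + 2))"
    using exists_cell[OF n2 s(3), of "max 1 (lev l)"] by auto
  have "(k + 1) * (j + 2) \<le> L" unfolding L_def by (rule mult_right_mono) (use k in auto)
  then have "max 1 (lev l) + k * (j + 2) + j + 1 \<le> lev h" using lev by simp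
  moreover have "lev b \<le> max 1 (lev l) + k * (j + 2)" using lb by simp
  ultimately show ?thesis unfolding climb_def using fair k b
    by (intro conjI allI impI exI[of _ "max 1 (lev l) + k * (j + 2)"] bexI[of _ "(b, h, w0)"]) auto
qed

lemma prob_popularity_ratio:
  "1 - 2 / N\<^sup>2 \<le> measure_pmf.prob (popularity_profile DM DW)
     {(PM, PW). \<forall>h h'. stable_husband PM PW w0 h \<and> stable_husband PM PW w0 h' \<longrightarrow> D h / D h' \<le> B powr (1 + K)}"
proof -
  let ?P = "pair_pmf PMs PWs"
  define S where "S = {(PM, PW). \<forall>h h'. stable_husband PM PW w0 h \<and> stable_husband PM PW w0 h'
      \<longrightarrow> D h / D h' \<le> B powr (1 + K)}"
  define F1 where "F1 = {(PM, PW). \<exists>v. hit PM PW v \<and> \<not> fair (PW v)}"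
  define F2 where "F2 = {(PM, PW). climb PM PW}"
  define F3 :: "(('m \<Rightarrow> 'w list) \<times> ('w \<Rightarrow> 'm list)) set"
    where "F3 = {(PM, PW). CARD('w) < card Y \<and> shared_unpopular PW}"
  have "measure_pmf.prob ?P (- S) \<le> measure_pmf.prob ?P (F1 \<union> F2 \<union> F3)"
  proof (rule prob_mono_pmf)
    fix P assume P: "P \<in> set_pmf ?P" "P \<in> - S"
    obtain PM PW where [simp]: "P = (PM, PW)" by (cases P)
    obtain h h' where h: "stable_husband PM PW w0 h" "stable_husband PM PW w0 h'" "B powr (1 + K) < D h / D h'"
      using P(2) by (auto simp: S_def not_le)
    have "P \<in> F2" if "P \<notin> F1" "P \<notin> F3"
      using climb_if_popularity_gap[OF _ _ _ _ h] P(1) that by (auto simp: F1_def F2_def F3_def)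
    then show "P \<in> F1 \<union> F2 \<union> F3" by blast
  qed
  also have "\<dots> \<le> real (n + 1) * (real (n - 1) * real (n - 1) / N ^ 5) + (real (n - 1))\<^sup>2 / N ^ 4 + 1 / N ^ 7"
  proof (intro prob_Un_le)
    show "measure_pmf.prob ?P F1 \<le> real (n + 1) * (real (n - 1) * real (n - 1) / N ^ 5)"
      unfolding F1_def by (rule prob_hit_unfair_le)
    show "measure_pmf.prob ?P F2 \<le> (real (n - 1))\<^sup>2 / N ^ 4"
      unfolding F2_def by (rule prob_pair_pmf_le[OF prob_climb_le])
    show "measure_pmf.prob ?P F3 \<le> 1 / N ^ 7"
    proof (cases "CARD('w) < card Y")
      case False
      then show ?thesis using N_ge by (simp add: F3_def)
    next
      case True
      then have n: "n = CARD('w)" by (simp add: n_def)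
      have "F3 = snd -` {PW. shared_unpopular PW}" using True by (auto simp: F3_def)
      then have "measure_pmf.prob ?P F3 = measure_pmf.prob (map_pmf snd ?P) {PW. shared_unpopular PW}"
        by (simp only: measure_map_pmf)
      also have "\<dots> \<le> CARD('w) * (n * (n * Q / B\<^sup>2))"
        unfolding map_snd_pair_pmf by (rule prob_shared_unpopular_le)
      also have "\<dots> = real n ^ 3 * (Q / B\<^sup>2)" by (simp add: n power3_eq_cube)
      also have "\<dots> \<le> N ^ 3 * (1 / N ^ 10)"
      proof (intro mult_mono power_mono n_ge)
        have "Q \<le> Q\<^sup>2" using Q(1) by (simp add: power2_eq_square)
        moreover have "N ^ 10 > 0" using N_ge by simp
        ultimately have "Q * N ^ 10 \<le> Q\<^sup>2 * N ^ 10" by (intro mult_right_mono) auto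
        also have "\<dots> = B\<^sup>2" by (simp add: B_def power_mult_distrib)
        finally show "Q / B\<^sup>2 \<le> 1 / N ^ 10" using B_gt N_ge by (simp add: field_simps)
      qed (use N_ge Q(1) in auto)
      also have "\<dots> = 1 / N ^ 7" using N_ge by (simp add: field_simps flip: power_add)
      finally show ?thesis .
    qed
  qed
  also have "\<dots> \<le> (N + 1) * ((N - 1) * (N - 1) / N ^ 5) + (N - 1)\<^sup>2 / N ^ 4 + 1 / N ^ 7"
  proof -
    have "real (n - 1) = real n - 1" using n_ge(1) by simp
    then have m: "real (n - 1) \<le> N - 1" "real (n + 1) \<le> N + 1" using n_ge(4) by simp_all
    show ?thesis using m N_ge
      by (intro add_mono mult_mono divide_right_mono power_mono) auto
  qed
  also have "\<dots> \<le> 2 / N\<^sup>2"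
  proof -
    \<comment> \<open>The left side equals \<open>N ^ 3 - N\<^sup>2 - N + 1\<close>. Dividing the
      bound by \<open>N ^ 5\<close> leaves a deficit of \<open>1 / N ^ 3\<close> below
      \<open>1 / N\<^sup>2\<close>, which pays for the \<open>1 / N ^ 7\<close> of
      \<open>F3\<close>.\<close>
    have "(N + 1) * ((N - 1) * (N - 1)) \<le> N ^ 3 - N\<^sup>2"
      using N_ge by (simp add: algebra_simps power2_eq_square power3_eq_cube)
    then have "(N + 1) * ((N - 1) * (N - 1) / N ^ 5) \<le> (N ^ 3 - N\<^sup>2) / N ^ 5"
      using N_ge by (simp add: divide_right_mono)
    also have "\<dots> = 1 / N\<^sup>2 - 1 / N ^ 3"
      using N_ge by (simp add: diff_divide_distrib) (simp add: eval_nat_numeral)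
    finally have "(N + 1) * ((N - 1) * (N - 1) / N ^ 5) \<le> 1 / N\<^sup>2 - 1 / N ^ 3" .
    moreover have "(N - 1)\<^sup>2 / N ^ 4 \<le> N\<^sup>2 / N ^ 4"
      using N_ge by (intro divide_right_mono power_mono) auto
    moreover have "N\<^sup>2 / N ^ 4 = 1 / N\<^sup>2"
      using N_ge by (simp add: eval_nat_numeral)
    moreover have "1 / N ^ 7 \<le> 1 / N ^ 3"
      using N_ge by (intro divide_left_mono power_increasing) auto
    ultimately show ?thesis by simp
  qed
  finally have "measure_pmf.prob ?P (- S) \<le> 2 / N\<^sup>2" .
  moreover have "measure_pmf.prob ?P (- S) = 1 - measure_pmf.prob ?P S"
    using measure_pmf.prob_compl[of S ?P] by (simp add: Compl_eq_Diff_UNIV)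
  ultimately show ?thesis by (simp add: popularity_profile_def S_def)
qed

end

section \<open>From the extended real maxima to real constants\<close>

lemma R_men_ratio:
  assumes "R_men DM < \<infinity>"
  shows "pmf (DM m) u \<le> enn2real (R_men DM) * pmf (DM m) v" "1 \<le> enn2real (R_men DM)"
proof -
  have pos: "0 < pmf (DM m) v" for m v
    using assms R_men_finite_iff[of DM] by (metis UNIV_I pmf_positive)
  have le: "pmf (DM m) u / pmf (DM m) v \<le> enn2real (R_men DM)" for m u v
  proof -
    have "ennreal (pmf (DM m) u) / ennreal (pmf (DM m) v) \<le> R_men DM"
      unfolding R_men_def by (rule Max_ge) (auto intro!: image_eqI[of _ _ "(m, u, v)"])
    then have "ennreal (pmf (DM m) u / pmf (DM m) v) \<le> R_men DM"
      using pos by (simp add: divide_ennreal)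
    then have "enn2real (ennreal (pmf (DM m) u / pmf (DM m) v)) \<le> enn2real (R_men DM)"
      using assms by (intro enn2real_mono) auto
    then show ?thesis by simp
  qed
  show "pmf (DM m) u \<le> enn2real (R_men DM) * pmf (DM m) v"
    using le[of m u v] pos[of m v] by (simp add: field_simps)
  show "1 \<le> enn2real (R_men DM)"
    using le[of m u u] pos[of m u] by simp
qed

lemma Q_women_term_le:
  "(ennreal (pmf (DW v) x) / ennreal (pmf (DW v) y)) * (ennreal (pmf (DW u) y) / ennreal (pmf (DW u) x)) \<le> Q_women DW"
  unfolding Q_women_def by (rule Max_ge) (auto intro!: image_eqI[of _ _ "(v, u, x, y)"])

lemma set_pmf_women_eq:
  assumes "Q_women DW < \<infinity>"
  shows "set_pmf (DW u) = set_pmf (DW v)"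
proof -
  have "set_pmf (DW u) \<subseteq> set_pmf (DW v)" for u v
  proof (rule ccontr)
    assume "\<not> set_pmf (DW u) \<subseteq> set_pmf (DW v)"
    then obtain y where y: "0 < pmf (DW u) y" "pmf (DW v) y = 0"
      by (auto simp: set_pmf_iff pmf_nonneg order.strict_iff_order)
    obtain x where x: "0 < pmf (DW v) x"
      using set_pmf_not_empty[of "DW v"] by (auto simp: set_pmf_iff pmf_nonneg order.strict_iff_order)
    \<comment> \<open>This factor may be infinite if \<open>u\<close> does not accept
      \<open>x\<close>, but it is not 0, so the product with the other, infinite factor is
      infinite.\<close>
    have "ennreal (pmf (DW u) y) / ennreal (pmf (DW u) x) \<noteq> 0"
      using y by (simp add: ennreal_divide_eq_0_iff)
    moreover have "ennreal (pmf (DW v) x) / ennreal (pmf (DW v) y) = \<infinity>"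
      using x y by (simp add: ennreal_divide_eq_top_iff)
    ultimately have "Q_women DW = \<infinity>"
      using Q_women_term_le[of DW v x y u] by (simp add: ennreal_top_mult top_unique)
    with assms show False by simp
  qed
  then show ?thesis by blast
qed

lemma Q_women_ratio:
  assumes "Q_women DW < \<infinity>" "0 < pmf (DW v) x" "0 < pmf (DW v) y" "0 < pmf (DW u) x" "0 < pmf (DW u) y"
  shows "pmf (DW v) x * pmf (DW u) y \<le> enn2real (Q_women DW) * (pmf (DW u) x * pmf (DW v) y)"
proof -
  have "ennreal (pmf (DW v) x / pmf (DW v) y * (pmf (DW u) y / pmf (DW u) x)) \<le> Q_women DW"
    using Q_women_term_le[of DW v x y u] assms by (simp add: divide_ennreal flip: ennreal_mult)
  then have "enn2real (ennreal (pmf (DW v) x / pmf (DW v) y * (pmf (DW u) y / pmf (DW u) x))) \<le> enn2real (Q_women DW)"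
    using assms by (intro enn2real_mono) auto
  then have "pmf (DW v) x / pmf (DW v) y * (pmf (DW u) y / pmf (DW u) x) \<le> enn2real (Q_women DW)"
    by simp
  then show ?thesis using assms by (simp add: field_simps)
qed

theorem theorem4:
  fixes DM :: "'m::finite \<Rightarrow> 'w::finite pmf"
    and DW :: "'w \<Rightarrow> 'm pmf"
    and w :: 'w
  defines "N \<equiv> real (min CARD('m) CARD('w))"
    and "R \<equiv> enn2real (R_men DM)"
    and "Q \<equiv> enn2real (Q_women DW)"
  assumes "R_men DM < \<infinity>" and "Q_women DW < \<infinity>"
  shows "measure_pmf.prob (popularity_profile DM DW)
           {(PM, PW). \<forall>h h'. stable_husband PM PW w h \<and> stable_husband PM PW w h' \<longrightarrow>
              pmf (DW w) h / pmf (DW w) h'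
                \<le> (N ^ 5 * Q) powr (1 + 4 * ln N * (1 + log 2 N) / ln (1 + 1 / R))}
         \<ge> 1 - 2 / N ^ 2"
proof (cases "2 \<le> min CARD('m) CARD('w)")
  case False
  moreover have "0 < CARD('m)" "0 < CARD('w)" by (simp_all add: card_gt_0_iff)
  ultimately have "N = 1" unfolding N_def by linarith
  \<comment> \<open>For \<open>N = 1\<close> the claimed lower bound is \<open>-1\<close>.\<close>
  then show ?thesis by (simp add: order_trans[OF _ measure_nonneg])
next
  case True
  define Y where "Y = set_pmf (DW w)"
  have Y: "set_pmf (DW v) = Y" for v unfolding Y_def by (rule set_pmf_women_eq) fact
  have posY: "x \<in> Y \<Longrightarrow> 0 < pmf (DW v) x" for v x using Y by (metis pmf_positive)
  have "Y \<noteq> {}" using set_pmf_not_empty[of "DW w"] Y by simp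
  then obtain x where x: "x \<in> Y" by blast
  define k where "k = card Y - min (card Y) CARD('w) + 1"
  define \<A> where "\<A> = {A. A \<subseteq> Y \<and> card A = k}"
  have "0 < card Y" "0 < CARD('w)" using x by (auto simp: card_gt_0_iff)
  then have "k \<le> card Y" unfolding k_def by linarith
  then have "\<A> \<noteq> {}" using obtain_subset_with_card_n[of k Y] by (auto simp: \<A>_def)
  then obtain Z where Z: "Z \<in> \<A>" "\<And>A. A \<in> \<A> \<Longrightarrow> sum (pmf (DW w)) Z \<le> sum (pmf (DW w)) A"
    using ex_min_if_finite[of "sum (pmf (DW w)) ` \<A>"] by (auto simp: not_less)
  interpret P: popularity_market DM DW w Y Z Q R
  proof
    show "set_pmf (DM m) = UNIV" for m using assms(4) R_men_finite_iff by blast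
    show "1 \<le> R" "pmf (DM m) u \<le> R * pmf (DM m) v" for m u v
      unfolding R_def using R_men_ratio[OF assms(4)] by auto
    show "pmf (DW v) x * pmf (DW u) y \<le> Q * (pmf (DW u) x * pmf (DW v) y)" if "x \<in> Y" "y \<in> Y" for u v x y
      unfolding Q_def by (rule Q_women_ratio[OF assms(5)]) (use that posY in auto)
    show "1 \<le> Q"
      using Q_women_ratio[OF assms(5), of w x x w] posY[OF x] by (simp add: Q_def)
  qed (use Y True Z in \<open>auto simp: \<A>_def k_def\<close>)
  have "P.N = N" by (simp add: P.N_def N_def)
  then show ?thesis
    using P.prob_popularity_ratio by (simp add: P.D_def P.B_def P.K_def)
qed

end
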